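(* Let $\mathfrak{C}$ be a covariance model. Assume that the test statistic $T:\mathbb{R}^n\to\mathbb{R}$ is Borel-measurable and is continuous on the complement of a closed set $N^\dagger$. Assume that $T$ and $N^\dagger$ are $G(\mathfrak{M}_0)$-invariant, and are also invariant w.r.t. addition of elements of a linear subspace $\mathcal{V}$ of $\mathbb{R}^n$. Define $\mathcal{L}=\mathrm{span}(\mathfrak{M}_0^{lin}\cup\mathcal{V})$ and assume that $\dim\mathcal{L}<n$. For a real number $C$ consider the conditions $$\text{(a)}\quad\sup_{\mu_0\in\mathfrak{M}_0}\sup_{0<\sigma^2<\infty}\sup_{\Sigma\in\mathfrak{C}}P_{\mu_0,\sigma^2\Sigma}(T\ge C)<1,$$ $$\text{(b)}\quad\inf_{\mu_0\in\mathfrak{M}_0}\inf_{0<\sigma^2<\infty}\inf_{\Sigma\in\mathfrak{C}}P_{\mu_0,\sigma^2\Sigma}(T\ge C)=0.$$ Then the following hold: 1. Suppose there exist two elements $\mathcal{S}_1$ and $\mathcal{S}_2$ of $\mathbb{H}$ such that $C(\mathcal{S}_1)\ne C(\mathcal{S}_2)$. Suppose further that for $i=1,2$ the set $N^\dagger$ is a $\lambda_{\mu_0+\mathcal{S}_i}$-null set for some $\mu_0\in\mathfrak{M}_0$ (and hence for all $\mu_0\in\mathfrak{M}_0$). Then any critical value $C$, $-\infty<C<\infty$, satisfying (a) also satisfies (b). 2. Suppose there exists an element $\mathcal{S}$ of $\mathbb{H}$ such that $N^\dagger$ is a $\lambda_{\mu_0+\mathcal{S}}$-null set for some $\mu_0\in\mathfrak{M}_0$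 (and hence for all $\mu_0\in\mathfrak{M}_0$). Then (a) implies that $C\ge C(\mathcal{S})$ must hold; furthermore, (a) implies (b), except possibly if $C=C(\mathcal{S})$ holds. 3. Suppose (b) holds for some $C$, $-\infty<C<\infty$. Then $$\inf_{0<\sigma^2<\infty}\inf_{\Sigma\in\mathfrak{C}}P_{\mu_1,\sigma^2\Sigma}(T\ge C)=0$$ for every $\mu_1\in\mathfrak{M}_1$, and $$\inf_{\mu_1\in\mathfrak{M}_1}\inf_{\Sigma\in\mathfrak{C}}P_{\mu_1,\sigma^2\Sigma}(T\ge C)=0$$ for every $\sigma^2\in(0,\infty)$.
   Context: Model: $n,k,q$ are positive integers with $1\le k<n$; $X\in\mathbb{R}^{n\times k}$ is a fixed matrix of rank $k$; $R\in\mathbb{R}^{q\times k}$ has rank $q\ge 1$; $r\in\mathbb{R}^q$. (One tests $R\beta=r$ against $R\beta\ne r$ in $\mathbf{Y}=X\beta+\mathbf{U}$, $\mathbf{U}\sim N(0,\sigma^2\Sigma)$, $0<\sigma^2<\infty$, $\Sigma\in\mathfrak{C}$.) $\mathfrak{M}_0=\{X\beta:R\beta=r\}$, $\mathfrak{M}_1=\{X\beta:R\beta\ne r\}$, $\mathfrak{M}_0^{lin}=\{X\beta:R\beta=0\}$. $P_{\mu,A}$ is the Gaussian measure on $\mathbb{R}^n$ with mean $\mu$ and covariance $A$; $P(T\ge C)$ means $P(\{y:T(y)\ge C\})$. Covariance model: a nonempty set $\mathfrak{C}$ of symmetric positive definite real $n\times n$ matrices such that $\Sigma\in\mathfrak{C}$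 implies $\delta\Sigma\notin\mathfrak{C}$ for every $\delta\ne1$. $G(\mathfrak{M}_0)$ is the group of maps $y\mapsto\delta(y-a)+a^*$ with $\delta\ne0$, $a,a^*\in\mathfrak{M}_0$; $T$ is $G(\mathfrak{M}_0)$-invariant if $T(g(y))=T(y)$ for all $y$ and $g\in G(\mathfrak{M}_0)$, and $N^\dagger$ is $G(\mathfrak{M}_0)$-invariant if $g(N^\dagger)=N^\dagger$ for all such $g$. Invariance w.r.t. addition of elements of $\mathcal{V}$: $T(y+v)=T(y)$, resp. $N^\dagger+v=N^\dagger$, for all $y\in\mathbb{R}^n$, $v\in\mathcal{V}$. For an affine subspace $\mathcal{A}$, $\lambda_{\mathcal{A}}$ is Lebesgue measure on $\mathcal{A}$, viewed as a measure on the Borel sets of $\mathbb{R}^n$ (point mass if $\dim\mathcal{A}=0$). For a linear subspace $\mathcal{L}$ with $\dim\mathcal{L}<n$: $\mathcal{L}(\Sigma)=\Pi_{\mathcal{L}^\perp}\Sigma\Pi_{\mathcal{L}^\perp}/\|\Pi_{\mathcal{L}^\perp}\Sigma\Pi_{\mathcal{L}^\perp}\|$ ($\Pi$ orthogonal projection, $\|\cdot\|$ any norm on $\mathbb{R}^{n\times n}$), $\mathcal{L}(\mathfrak{C})=\{\mathcal{L}(\Sigma):\Sigma\in\mathfrak{C}\}$, and $\mathbb{J}(\mathcal{L},\mathfrak{C})=\{\mathrm{span}(\bar\Sigma):\bar\Sigma\in\mathrm{cl}(\mathcal{L}(\mathfrak{C})),\ \mathrm{rank}(\bar\Sigma)<n-\dim(\mathcal{L})\}$,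 with $\mathrm{span}$ of a matrix its column space and closure in $\mathbb{R}^{n\times n}$. $\mathbb{H}$ is the set of all $\mathcal{S}\in\mathbb{J}(\mathcal{L},\mathfrak{C})$ such that, for $\mu_0\in\mathfrak{M}_0$, $T$ is $\lambda_{\mu_0+\mathcal{S}}$-almost everywhere equal to a real constant, denoted $C(\mathcal{S})$ (by $G(\mathfrak{M}_0)$-invariance neither this property nor the constant depends on the choice of $\mu_0\in\mathfrak{M}_0$). *)

theory Defs
  imports "HOL-Analysis.Analysis"
begin

section \<open>Gaussian and Lebesgue measures\<close>

definition sym_pos_def :: "real^'n^'n \<Rightarrow> bool" where
  "sym_pos_def A \<longleftrightarrow> transpose A = A \<and> (\<forall>x. x \<noteq> 0 \<longrightarrow> 0 < x \<bullet> (A *v x))"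

text \<open>The Gaussian measure with mean \<^term>\<open>\<mu>\<close> and covariance matrix \<^term>\<open>A\<close>, given by its
  Lebesgue density. It is meaningful for symmetric positive definite \<^term>\<open>A\<close>; singular
  covariance matrices are not covered.\<close>

definition gaussian_measure :: "real^'n \<Rightarrow> real^'n^'n \<Rightarrow> (real^'n) measure" where
  "gaussian_measure \<mu> A = density lborel (\<lambda>y. ennreal
     (exp (- ((y - \<mu>) \<bullet> (matrix_inv A *v (y - \<mu>))) / 2) / sqrt ((2 * pi) ^ CARD('n) * det A)))"

text \<open>Lebesgue measure on a nonempty affine subspace \<^term>\<open>A\<close>, as a measure on the Borel sets of
  the ambient space: the image of the product Lebesgue measure under the isometric parametrisation
  \<^term>\<open>\<lambda>f. a + (\<Sum>b\<in>B. f b *\<^sub>R b)\<close>, where \<^term>\<open>a \<in> A\<close> and \<^term>\<open>B\<close> is an orthonormal basis of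
  the direction space of \<^term>\<open>A\<close>. The measure does not depend on the choice of \<^term>\<open>a\<close> and
  \<^term>\<open>B\<close>. In dimension zero \<^term>\<open>B\<close> is empty and the measure is the point mass at \<^term>\<open>a\<close>.\<close>

definition direction_space :: "'a::real_vector set \<Rightarrow> 'a set" where
  "direction_space A = {x - y | x y. x \<in> A \<and> y \<in> A}"

definition orthonormal_basis_of :: "'a::euclidean_space set \<Rightarrow> 'a set \<Rightarrow> bool" where
  "orthonormal_basis_of B S \<longleftrightarrow> pairwise orthogonal B \<and> (\<forall>b\<in>B. norm b = 1) \<and> span B = S"

definition affine_lebesgue :: "'a::euclidean_space set \<Rightarrow> 'a measure" where
  "affine_lebesgue A =
     (let a = (SOME a. a \<in> A);
          B = (SOME B. orthonormal_basis_of B (direction_space A))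
      in distr (PiM B (\<lambda>_. lborel :: real measure)) borel (\<lambda>f. a + (\<Sum>b\<in>B. f b *\<^sub>R b)))"

section \<open>The linear model and the covariance model\<close>

definition M0 :: "real^'k^'n \<Rightarrow> real^'k^'q \<Rightarrow> real^'q \<Rightarrow> (real^'n) set" where
  "M0 X R r = {X *v \<beta> | \<beta>. R *v \<beta> = r}"

definition M1 :: "real^'k^'n \<Rightarrow> real^'k^'q \<Rightarrow> real^'q \<Rightarrow> (real^'n) set" where
  "M1 X R r = {X *v \<beta> | \<beta>. R *v \<beta> \<noteq> r}"

definition M0_lin :: "real^'k^'n \<Rightarrow> real^'k^'q \<Rightarrow> (real^'n) set" where
  "M0_lin X R = {X *v \<beta> | \<beta>. R *v \<beta> = 0}"

definition covariance_model :: "(real^'n^'n) set \<Rightarrow> bool" where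
  "covariance_model Cov \<longleftrightarrow> Cov \<noteq> {} \<and> (\<forall>\<Sigma>\<in>Cov. sym_pos_def \<Sigma>) \<and>
     (\<forall>\<Sigma>\<in>Cov. \<forall>\<delta>::real. \<delta> \<noteq> 1 \<longrightarrow> \<delta> *\<^sub>R \<Sigma> \<notin> Cov)"

section \<open>Invariance\<close>

definition G_group :: "'a::real_vector set \<Rightarrow> ('a \<Rightarrow> 'a) set" where
  "G_group M = {\<lambda>y. \<delta> *\<^sub>R (y - a) + a' | \<delta> a a'. \<delta> \<noteq> 0 \<and> a \<in> M \<and> a' \<in> M}"

definition fun_invariant :: "('a \<Rightarrow> 'a) set \<Rightarrow> ('a \<Rightarrow> 'b) \<Rightarrow> bool" where
  "fun_invariant G T \<longleftrightarrow> (\<forall>g\<in>G. \<forall>y. T (g y) = T y)"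

definition set_invariant :: "('a \<Rightarrow> 'a) set \<Rightarrow> 'a set \<Rightarrow> bool" where
  "set_invariant G N \<longleftrightarrow> (\<forall>g\<in>G. g ` N = N)"

definition translation_maps :: "'a::plus set \<Rightarrow> ('a \<Rightarrow> 'a) set" where
  "translation_maps V = {\<lambda>y. y + v | v. v \<in> V}"

section \<open>Concentration spaces\<close>

definition is_norm :: "('a::real_vector \<Rightarrow> real) \<Rightarrow> bool" where
  "is_norm N \<longleftrightarrow> (\<forall>x. N x = 0 \<longleftrightarrow> x = 0) \<and> (\<forall>c x. N (c *\<^sub>R x) = \<bar>c\<bar> * N x) \<and>
     (\<forall>x y. N (x + y) \<le> N x + N y)"

definition proj_matrix :: "(real^'n) set \<Rightarrow> real^'n^'n" where
  "proj_matrix S = matrix (\<lambda>x. THE p. p \<in> S \<and> x - p \<in> orthogonal_comp S)"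

definition normalized_cov ::
  "(real^'n^'n \<Rightarrow> real) \<Rightarrow> (real^'n) set \<Rightarrow> real^'n^'n \<Rightarrow> real^'n^'n" where
  "normalized_cov N L \<Sigma> =
     (let P = proj_matrix (orthogonal_comp L); S = P ** \<Sigma> ** P in (1 / N S) *\<^sub>R S)"

definition J_set ::
  "(real^'n^'n \<Rightarrow> real) \<Rightarrow> (real^'n) set \<Rightarrow> (real^'n^'n) set \<Rightarrow> (real^'n) set set" where
  "J_set N L Cov = {span (columns S) | S.
     S \<in> closure (normalized_cov N L ` Cov) \<and> rank S < CARD('n) - dim L}"

text \<open>Here \<^term>\<open>M\<close> plays the role of the set of null means and \<^term>\<open>J\<close> that of the collection of
  concentration spaces. By invariance of \<^term>\<open>T\<close> the constant in \<open>H_set\<close> is the same for all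
  \<^term>\<open>\<mu>0 \<in> M\<close>; it is the value of \<open>H_const\<close>.\<close>

definition H_set ::
  "('a::euclidean_space \<Rightarrow> real) \<Rightarrow> 'a set \<Rightarrow> 'a set set \<Rightarrow> 'a set set" where
  "H_set T M J = {S \<in> J. \<forall>\<mu>0\<in>M. \<exists>c. AE y in affine_lebesgue ((+) \<mu>0 ` S). T y = c}"

definition H_const :: "('a::euclidean_space \<Rightarrow> real) \<Rightarrow> 'a set \<Rightarrow> 'a set \<Rightarrow> real" where
  "H_const T M S = (THE c. \<forall>\<mu>0\<in>M. AE y in affine_lebesgue ((+) \<mu>0 ` S). T y = c)"

section \<open>Rejection probabilities\<close>

definition rej_prob :: "(real^'n \<Rightarrow> real) \<Rightarrow> real \<Rightarrow> real^'n \<Rightarrow> real^'n^'n \<Rightarrow> real" where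
  "rej_prob T C \<mu> A = measure (gaussian_measure \<mu> A) {y. C \<le> T y}"

definition cond_a :: "(real^'n) set \<Rightarrow> (real^'n^'n) set \<Rightarrow> (real^'n \<Rightarrow> real) \<Rightarrow> real \<Rightarrow> bool" where
  "cond_a M Cov T C \<longleftrightarrow>
     (SUP \<mu>0\<in>M. SUP \<sigma>2\<in>{0<..}. SUP \<Sigma>\<in>Cov. rej_prob T C \<mu>0 (\<sigma>2 *\<^sub>R \<Sigma>)) < 1"

definition cond_b :: "(real^'n) set \<Rightarrow> (real^'n^'n) set \<Rightarrow> (real^'n \<Rightarrow> real) \<Rightarrow> real \<Rightarrow> bool" where
  "cond_b M Cov T C \<longleftrightarrow>
     (INF \<mu>0\<in>M. INF \<sigma>2\<in>{0<..}. INF \<Sigma>\<in>Cov. rej_prob T C \<mu>0 (\<sigma>2 *\<^sub>R \<Sigma>)) = 0"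

end

theory Submission
  imports Defs "HOL-Probability.Distributions"
begin

text \<open>Factor \<open>\<Sigma> = B B\<^sup>T\<close>, so that \<open>P\<^bsub>\<mu>,\<Sigma>\<^esub>\<close> is the law of \<open>\<mu> + B Z\<close> with \<open>Z\<close> standard Gaussian. By invariance,
  \<open>T (\<mu> + B Z) = T (\<mu> + A Z)\<close> for a rescaled projection \<open>A\<close> of \<open>B\<close> onto the orthogonal complement of
  \<open>L\<close>, with \<open>A A\<^sup>T\<close> the normalized covariance matrix. If these matrices converge to \<open>\<Sigma>\<^sub>0\<close>, the factors
  are bounded, and along a subsequence they converge to some \<open>A\<^sub>0\<close> with \<open>A\<^sub>0 A\<^sub>0\<^sup>T = \<Sigma>\<^sub>0\<close>; no square roots of
  singular matrices are involved. Almost surely \<open>\<mu> + A\<^sub>0 Z\<close> is a continuity point of \<open>T\<close> with value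
  \<open>C(S)\<close>, so the rejection probabilities tend to 1 if \<open>C < C(S)\<close> and to 0 if \<open>C > C(S)\<close>.
  Under the alternative, scaling the variance up or moving the mean towards the null amounts to
  a small shift of the mean, and Gaussian measures are continuous in the mean in total variation.\<close>

section \<open>Matrices\<close>

lemma inner_matrix_vector_mult:
  fixes A :: "real^'n^'m"
  shows "x \<bullet> (A *v y) = (transpose A *v x) \<bullet> y"
  by (metis dot_lmul_matrix transpose_matrix_vector)

lemma matrix_inv_inverse:
  assumes "invertible A"
  shows "A ** matrix_inv A = mat 1" "matrix_inv A ** A = mat 1"
  using someI_ex[OF assms[unfolded invertible_def]] by (simp_all add: matrix_inv_def)

text \<open>Gram-Schmidt for the inner product given by \<open>A\<close>. Fewer than n vectors
  \<open>A *v b j\<close> leave room for a nonzero vector orthogonal to all of them, which is then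
  normalized in the \<open>A\<close>-norm.\<close>

lemma sym_pos_def_orthonormal_family:
  fixes A :: "real^'n^'n" and I :: "'n set"
  assumes A: "sym_pos_def A"
  shows "\<exists>b :: 'n \<Rightarrow> real^'n. \<forall>i\<in>I. \<forall>j\<in>I. b i \<bullet> (A *v b j) = (if i = j then 1 else 0)"
  using finite[of I]
proof (induction I)
  case empty
  then show ?case by simp
next
  case (insert k I)
  then obtain b :: "'n \<Rightarrow> real^'n"
    where b: "\<And>i j. i \<in> I \<Longrightarrow> j \<in> I \<Longrightarrow> b i \<bullet> (A *v b j) = (if i = j then 1 else 0)"
    by blast
  have "card I < CARD('n)"
    using insert by (intro psubset_card_mono) auto
  moreover have "dim ((\<lambda>j. A *v b j) ` I) \<le> card I"
    by (meson card_image_le dim_le_card' finite finite_imageI order_trans)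
  ultimately obtain x where x: "x \<noteq> 0" "\<And>y. y \<in> span ((\<lambda>j. A *v b j) ` I) \<Longrightarrow> orthogonal x y"
    using orthogonal_to_subspace_exists[of "(\<lambda>j. A *v b j) ` I"] by auto
  have sym: "u \<bullet> (A *v v) = v \<bullet> (A *v u)" for u v
    using A by (metis inner_commute inner_matrix_vector_mult sym_pos_def_def)
  define y where "y = (1 / sqrt (x \<bullet> (A *v x))) *\<^sub>R x"
  have pos: "0 < x \<bullet> (A *v x)"
    using A x by (simp add: sym_pos_def_def)
  have yy: "y \<bullet> (A *v y) = 1"
    using pos by (simp add: y_def matrix_vector_mult_scaleR field_simps)
  have yb: "y \<bullet> (A *v b j) = 0" if "j \<in> I" for j
    using x(2)[of "A *v b j"] that by (simp add: y_def orthogonal_def span_base)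
  have by': "b j \<bullet> (A *v y) = 0" if "j \<in> I" for j
    using yb[OF that] sym by simp
  have bI: "(b(k := y)) i = b i" if "i \<in> I" for i
    using that insert by auto
  show ?case
    using b yy yb by' \<open>k \<notin> I\<close> by (intro exI[of _ "b(k := y)"]) (auto simp: bI)
qed

text \<open>If the rows of \<open>D\<close> form an \<open>A\<close>-orthonormal basis, then
  \<open>D ** A ** transpose D\<close> is the identity, and the inverse of \<open>D\<close> is the
  required factor.\<close>

lemma sym_pos_def_factorization:
  fixes A :: "real^'n^'n"
  assumes A: "sym_pos_def A"
  obtains B :: "real^'n^'n" where "invertible B" "A = B ** transpose B"
proof -
  obtain b :: "'n \<Rightarrow> real^'n"
    where b: "\<And>i j. b i \<bullet> (A *v b j) = (if i = j then 1 else 0)"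
    using sym_pos_def_orthonormal_family[OF A, of UNIV] by auto
  define D where "D = (\<chi> i. b i)"
  have "(D ** A ** transpose D) $ i $ j = b i \<bullet> (A *v b j)" for i j
    by (simp add: D_def matrix_matrix_mult_def transpose_def matrix_vector_mult_def inner_vec_def
        sum_distrib_left sum_distrib_right mult.assoc) (rule sum.swap)
  then have "D ** A ** transpose D = mat 1"
    using b by (simp add: vec_eq_iff mat_def)
  then have "invertible D"
    by (metis invertible_right_inverse matrix_mul_assoc)
  then have D: "D ** matrix_inv D = mat 1" "matrix_inv D ** D = mat 1"
    by (simp_all add: matrix_inv_inverse)
  have Dt: "transpose D ** transpose (matrix_inv D) = mat 1"
    by (metis D(2) matrix_transpose_mul transpose_mat)
  have "A = matrix_inv D ** (D ** A ** transpose D) ** transpose (matrix_inv D)"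
    by (metis D(2) Dt matrix_mul_assoc matrix_mul_lid matrix_mul_rid)
  also have "\<dots> = matrix_inv D ** transpose (matrix_inv D)"
    using \<open>D ** A ** transpose D = mat 1\<close> by (simp add: matrix_mul_rid)
  finally show thesis
    using D by (intro that[of "matrix_inv D"]) (auto simp: invertible_def)
qed

lemma sym_pos_def_scaleR:
  assumes "sym_pos_def A" "0 < c"
  shows "sym_pos_def (c *\<^sub>R A)"
  using assms by (auto simp: sym_pos_def_def transpose_scalar scaleR_matrix_vector_assoc[symmetric])

text \<open>If the left range were strictly smaller, some nonzero \<open>y\<close> in the range of
  \<open>A\<close> would be orthogonal to it. Then the squared norm of
  \<open>transpose A *v y\<close> vanishes, and \<open>y = A *v w\<close> is orthogonal to itself.
  This identifies a concentration space with the range of any factor of the limit matrix.\<close>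

lemma range_mult_transpose:
  fixes A :: "real^'n^'m"
  shows "range ((*v) (A ** transpose A)) = range ((*v) A)"
proof
  show "range ((*v) (A ** transpose A)) \<subseteq> range ((*v) A)"
    by (auto simp flip: matrix_vector_mul_assoc)
next
  let ?U = "range ((*v) (A ** transpose A))"
  have sub: "subspace ?U"
    by (intro linear_subspace_image) auto
  show "range ((*v) A) \<subseteq> ?U"
  proof (rule ccontr)
    assume neg: "\<not> ?thesis"
    have sub2: "subspace (range ((*v) A))"
      by (intro linear_subspace_image) auto
    have "span ?U \<subset> span (range ((*v) A))"
      unfolding span_eq_iff[THEN iffD2, OF sub] span_eq_iff[THEN iffD2, OF sub2]
      using neg by (auto simp flip: matrix_vector_mul_assoc)
    then obtain y where y: "y \<noteq> 0" "y \<in> span (range ((*v) A))" "\<And>z. z \<in> span ?U \<Longrightarrow> orthogonal y z"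
      using orthogonal_to_subspace_exists_gen by blast
    have "orthogonal y ((A ** transpose A) *v y)"
      by (intro y span_base) auto
    then have "transpose A *v y = 0"
      by (simp add: orthogonal_def inner_matrix_vector_mult flip: matrix_vector_mul_assoc)
    moreover obtain w where "y = A *v w"
      using y(2) unfolding span_eq_iff[THEN iffD2, OF sub2] by auto
    ultimately have "y \<bullet> y = 0"
      by (metis inner_matrix_vector_mult inner_zero_left)
    then show False
      using y by simp
  qed
qed

lemma span_columns_eq_range:
  fixes A :: "real^'n^'m"
  shows "span (columns A) = range ((*v) A)"
proof
  show "span (columns A) \<subseteq> range ((*v) A)"
    by (intro span_minimal linear_subspace_image) (auto simp: columns_image_basis)
  show "range ((*v) A) \<subseteq> span (columns A)"
    using matrix_vector_mult_in_columnspace by auto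
qed

text \<open>The squared norm of a factor is the trace of its Gram matrix, so bounded Gram matrices
  have bounded factors.\<close>

lemma inner_self_eq_trace_mult_transpose:
  fixes A :: "real^'n^'m"
  shows "A \<bullet> A = (\<Sum>i\<in>UNIV. (A ** transpose A) $ i $ i)"
  by (simp add: inner_vec_def matrix_matrix_mult_def transpose_def)

text \<open>The description in \<open>proj_matrix\<close> has to be shown to denote, and to denote a
  linear map, before \<open>matrix\<close> represents it. Symmetry follows because both
  \<open>x \<bullet> p y\<close> and \<open>p x \<bullet> y\<close> equal
  \<open>p x \<bullet> p y\<close>.\<close>

lemma proj_matrix_props:
  fixes S :: "(real^'n) set"
  assumes S: "subspace S"
  shows "proj_matrix S *v x \<in> S"
    and "x - proj_matrix S *v x \<in> orthogonal_comp S"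
    and "transpose (proj_matrix S) = proj_matrix S"
proof -
  define p where "p = (\<lambda>x. THE p. p \<in> S \<and> x - p \<in> orthogonal_comp S)"
  have ex: "\<exists>!p. p \<in> S \<and> x - p \<in> orthogonal_comp S" for x
  proof -
    obtain u v where "u \<in> S" "v \<in> orthogonal_comp S" "x = u + v"
      using subspace_sum_orthogonal_comp[OF S] by (metis UNIV_I set_plus_elim)
    moreover have "q = u" if "q \<in> S" "x - q \<in> orthogonal_comp S" for q
    proof -
      \<comment> \<open>Two candidates differ by a vector of \<open>S\<close> that is also
        orthogonal to \<open>S\<close>.\<close>
      have "q - u \<in> S"
        using that \<open>u \<in> S\<close> S by (simp add: subspace_diff)
      moreover have "q - u = v - (x - q)"
        using \<open>x = u + v\<close> by simp
      then have "q - u \<in> orthogonal_comp S"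
        using that \<open>v \<in> _\<close> subspace_orthogonal_comp[of S] by (metis subspace_diff)
      ultimately show "q = u"
        by (auto simp: orthogonal_comp_def orthogonal_def)
    qed
    ultimately show ?thesis
      by (intro ex1I[of _ u]) auto
  qed
  have p: "p x \<in> S" "x - p x \<in> orthogonal_comp S" for x
    using theI'[OF ex[of x]] by (auto simp: p_def)
  have p_eq: "p x = q" if "q \<in> S" "x - q \<in> orthogonal_comp S" for x q
    using ex[of x] p[of x] that by blast
  note C = subspace_orthogonal_comp[of S]
  have "linear p"
  proof
    show "p (x + y) = p x + p y" for x y
    proof (rule p_eq)
      have "x + y - (p x + p y) = (x - p x) + (y - p y)" by simp
      then show "x + y - (p x + p y) \<in> orthogonal_comp S"
        using p C by (metis subspace_add)
    qed (use p S in \<open>simp add: subspace_add\<close>)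
    show "p (c *\<^sub>R x) = c *\<^sub>R p x" for c x
    proof (rule p_eq)
      show "c *\<^sub>R x - c *\<^sub>R p x \<in> orthogonal_comp S"
        using p C by (metis scaleR_right_diff_distrib subspace_scale)
    qed (use p S in \<open>simp add: subspace_scale\<close>)
  qed
  then have P: "proj_matrix S *v x = p x" for x
    by (simp add: proj_matrix_def p_def)
  show "proj_matrix S *v x \<in> S" "x - proj_matrix S *v x \<in> orthogonal_comp S"
    using p by (simp_all add: P)
  have *: "x \<bullet> p y = p x \<bullet> p y" for x y
    using p(2)[of x] p(1)[of y]
    by (auto simp: orthogonal_comp_def orthogonal_def inner_diff inner_commute)
  have "x \<bullet> p y = p x \<bullet> y" for x y
    by (metis * inner_commute)
  then have "(transpose (proj_matrix S) *v x) \<bullet> y = (proj_matrix S *v x) \<bullet> y" for x y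
    by (simp only: P flip: inner_matrix_vector_mult)
  then have "transpose (proj_matrix S) *v x = proj_matrix S *v x" for x
    by (metis vector_eq_rdot)
  then show "transpose (proj_matrix S) = proj_matrix S"
    by (simp add: matrix_eq)
qed

section \<open>Null sets of affine subspaces\<close>

lemma product_sigma_finite_lborel: "product_sigma_finite (\<lambda>_. lborel :: 'a::euclidean_space measure)"
  unfolding product_sigma_finite_def by (simp add: lborel.sigma_finite_measure_axioms)

lemma measurable_PiM_lborel_translate:
  fixes g :: "'i \<Rightarrow> real"
  shows "(\<lambda>f. \<lambda>i\<in>I. f i + g i) \<in> measurable (PiM I (\<lambda>_. lborel)) (PiM I (\<lambda>_. lborel))"
proof (rule measurable_restrict)
  show "(\<lambda>f. f i + g i) \<in> measurable (PiM I (\<lambda>_. lborel)) lborel" if "i \<in> I" for i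
    using borel_measurable_add[OF measurable_component_singleton[OF that,
          of "\<lambda>_. lborel :: real measure", simplified], of "\<lambda>_. g i"]
    by simp
qed

text \<open>A product measure is determined by its values on boxes, where translation invariance
  holds coordinate by coordinate. The restriction to \<open>I\<close> keeps the translated function
  in the extensional function space.\<close>

lemma distr_PiM_lborel_translate:
  fixes g :: "'i \<Rightarrow> real"
  assumes I: "finite I"
  shows "distr (PiM I (\<lambda>_. lborel)) (PiM I (\<lambda>_. lborel)) (\<lambda>f. \<lambda>i\<in>I. f i + g i) = PiM I (\<lambda>_. lborel)"
    (is "distr ?PM ?PM ?t = ?PM")
proof (rule product_sigma_finite.PiM_eqI[OF product_sigma_finite_lborel I])
  have t: "?t \<in> measurable ?PM ?PM"
    by (rule measurable_PiM_lborel_translate)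
  fix D :: "'i \<Rightarrow> real set" assume D: "\<And>i. i \<in> I \<Longrightarrow> D i \<in> sets lborel"
  have tr: "emeasure lborel ((\<lambda>x. x + g i) -` D i) = emeasure lborel (D i)" if "i \<in> I" for i
  proof -
    have "emeasure lborel (D i) = emeasure (distr lborel borel ((+) (g i))) (D i)"
      by (simp add: lborel_distr_plus)
    also have "\<dots> = emeasure lborel ((\<lambda>x. x + g i) -` D i)"
      using D[OF that] by (subst emeasure_distr) (auto simp: vimage_def add.commute)
    finally show ?thesis by simp
  qed
  have ms: "(\<lambda>x. x + g i) -` D i \<in> sets lborel" if "i \<in> I" for i
    using measurable_sets_borel[of "\<lambda>x. x + g i" borel "D i"] D[OF that] by simp
  have pre: "?t -` (Pi\<^sub>E I D) \<inter> space ?PM = Pi\<^sub>E I (\<lambda>i. (\<lambda>x. x + g i) -` D i)"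
    by (auto simp: space_PiM PiE_def Pi_def)
  have "emeasure (distr ?PM ?PM ?t) (Pi\<^sub>E I D) = emeasure ?PM (Pi\<^sub>E I (\<lambda>i. (\<lambda>x. x + g i) -` D i))"
    using D I t by (simp add: emeasure_distr pre sets_PiM_I_finite)
  also have "\<dots> = (\<Prod>i\<in>I. emeasure lborel ((\<lambda>x. x + g i) -` D i))"
    using ms by (intro product_sigma_finite.emeasure_PiM[OF product_sigma_finite_lborel I])
  also have "\<dots> = (\<Prod>i\<in>I. emeasure lborel (D i))"
    by (intro prod.cong tr refl)
  finally show "emeasure (distr ?PM ?PM ?t) (Pi\<^sub>E I D) = (\<Prod>i\<in>I. emeasure lborel (D i))" .
qed simp

lemma pair_sigma_finite_PiM_lborel:
  assumes "finite I"
  shows "pair_sigma_finite (PiM I (\<lambda>_. lborel :: real measure)) (lborel :: 'b::euclidean_space measure)"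
  by (intro pair_sigma_finite.intro product_sigma_finite.sigma_finite product_sigma_finite_lborel assms
      lborel.sigma_finite_measure_axioms)

text \<open>The unit cube has measure 1, also for empty \<open>I\<close>, where it is a single
  point. Hence a statement that does not mention the variable and holds almost everywhere is
  true.\<close>

lemma not_AE_PiM_lborel_False:
  assumes I: "finite I"
  shows "\<not> (AE f in PiM I (\<lambda>_. lborel :: real measure). False)"
proof
  let ?PM = "PiM I (\<lambda>_. lborel :: real measure)"
  assume "AE f in ?PM. False"
  then have "emeasure ?PM (space ?PM) = 0"
    by (simp add: ae_filter_eq_bot_iff flip: trivial_limit_def)
  moreover have "emeasure ?PM (Pi\<^sub>E I (\<lambda>_. {0..1})) \<le> emeasure ?PM (space ?PM)"
    by (rule emeasure_space)
  moreover have "emeasure ?PM (Pi\<^sub>E I (\<lambda>_. {0..1})) = 1"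
    using I by (subst product_sigma_finite.emeasure_PiM[OF product_sigma_finite_lborel]) auto
  ultimately show False
    by simp
qed

lemma borel_measurable_matrix_vector_mult [measurable]:
  fixes A :: "real^'m^'n"
  assumes [measurable]: "f \<in> borel_measurable M"
  shows "(\<lambda>x. A *v f x) \<in> borel_measurable M"
proof -
  have "(*v) A \<in> borel_measurable borel"
    by (intro borel_measurable_continuous_onI linear_continuous_on linear_conv_bounded_linear[THEN iffD1]) auto
  then show ?thesis
    by measurable
qed

text \<open>Fubini's theorem is applied to the sets \<open>{(f, z). a + h f + A *v z \<in> E}\<close>, where \<open>h\<close>
  parametrises the range of \<open>A\<close>. Each slice at fixed \<open>z\<close> is a translate of a null set, and each slice
  at fixed \<open>f\<close> is a translate of the set that has to be shown to be null.\<close>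

lemma AE_affine_lebesgueD:
  fixes A :: "real^'m^'n" and P :: "real^'n \<Rightarrow> bool"
  assumes AE: "AE y in affine_lebesgue ((+) \<mu> ` range ((*v) A)). P y"
  shows "AE z in lborel. P (\<mu> + A *v z)"
proof -
  define S where "S = range ((*v) A)"
  have S: "subspace S"
    unfolding S_def by (intro linear_subspace_image) auto
  define a where "a = (SOME a. a \<in> (+) \<mu> ` S)"
  define B where "B = (SOME B. orthonormal_basis_of B (direction_space ((+) \<mu> ` S)))"
  have "direction_space ((+) \<mu> ` S) = S"
  proof
    show "direction_space ((+) \<mu> ` S) \<subseteq> S"
      using S by (auto simp: direction_space_def intro: subspace_diff)
    show "S \<subseteq> direction_space ((+) \<mu> ` S)"
      using subspace_0[OF S] by (force simp: direction_space_def)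
  qed
  moreover obtain B' where "orthonormal_basis_of B' S"
    using orthonormal_basis_subspace[OF S] unfolding orthonormal_basis_of_def by metis
  ultimately have B: "orthonormal_basis_of B S"
    unfolding B_def by (metis someI)
  have "a \<in> (+) \<mu> ` S"
    unfolding a_def using subspace_0[OF S] by (intro someI_ex[of "\<lambda>a. a \<in> (+) \<mu> ` S"]) blast
  \<comment> \<open>The base point picked by the choice operator is unknown, but it differs from
    \<open>\<mu>\<close> by a vector in the range of \<open>A\<close>, which a translation of
    \<open>z\<close> absorbs below.\<close>
  then obtain z0 where z0: "a = \<mu> + A *v z0"
    by (auto simp: S_def)
  have "independent B"
    using B by (intro pairwise_orthogonal_independent) (auto simp: orthonormal_basis_of_def)
  then have finB: "finite B"
    by (rule independent_imp_finite)
  define h where "h = (\<lambda>f. \<Sum>b\<in>B. f b *\<^sub>R b :: real^'n)"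
  have S_h: "\<exists>f. s = h f" if "s \<in> S" for s
  proof -
    have "s \<in> span B"
      using that B by (simp add: orthonormal_basis_of_def)
    then show ?thesis
      unfolding span_finite[OF finB] h_def by blast
  qed
  have h_S: "h f \<in> S" for f
  proof -
    have "h f \<in> span B"
      unfolding h_def by (intro span_sum span_scale span_base)
    then show ?thesis
      using B by (simp add: orthonormal_basis_of_def)
  qed
  let ?PM = "PiM B (\<lambda>_. lborel :: real measure)"
  have h_meas[measurable]: "h \<in> borel_measurable ?PM"
    unfolding h_def
  proof (intro borel_measurable_sum borel_measurable_scaleR borel_measurable_const)
    show "(\<lambda>f. f b) \<in> borel_measurable ?PM" if "b \<in> B" for b
      using measurable_component_singleton[OF that, of "\<lambda>_. lborel :: real measure"] by simp
  qed
  have eq: "affine_lebesgue ((+) \<mu> ` range ((*v) A)) = distr ?PM borel (\<lambda>f. a + h f)"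
    unfolding affine_lebesgue_def Let_def h_def S_def[symmetric] a_def[symmetric] B_def[symmetric] ..
  \<comment> \<open>\<open>P\<close> need not be measurable, so its complement is enclosed in a
    Borel null set.\<close>
  obtain E where E: "{y. \<not> P y} \<subseteq> E" "E \<in> sets borel" "emeasure (distr ?PM borel (\<lambda>f. a + h f)) E = 0"
    using AE unfolding eq
    by (elim AE_E) (simp add: space_borel)
  note [measurable] = E(2)
  have E0: "AE f in ?PM. a + h f \<notin> E"
  proof -
    have "AE y in distr ?PM borel (\<lambda>f. a + h f). y \<notin> E"
      using E by (intro AE_not_in null_setsI) auto
    then show ?thesis
      by (subst (asm) AE_distr_iff) auto
  qed
  have shift: "AE f in ?PM. a + h f + s \<notin> E" if s: "s \<in> S" for s
  proof -
    \<comment> \<open>A shift by \<open>s\<close> is a translation of the coordinates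
      \<open>f\<close> by those of \<open>s\<close>.\<close>
    obtain g where g: "s = h g"
      using S_h[OF s] by blast
    have meas: "(\<lambda>f. \<lambda>b\<in>B. f b + g b) \<in> measurable ?PM ?PM"
      by (rule measurable_PiM_lborel_translate)
    have "AE f in distr ?PM ?PM (\<lambda>f. \<lambda>b\<in>B. f b + g b). a + h f \<notin> E"
      unfolding distr_PiM_lborel_translate[OF finB] by (rule E0)
    then have "AE f in ?PM. a + h (\<lambda>b\<in>B. f b + g b) \<notin> E"
      by (subst (asm) AE_distr_iff[OF meas]) auto
    moreover have "h (\<lambda>b\<in>B. f b + g b) = h f + s" for f
      by (simp add: h_def g scaleR_add_left sum.distrib)
    ultimately show ?thesis
      by (simp add: add.assoc)
  qed
  have "AE z in lborel. AE f in ?PM. a + h f + A *v z \<notin> E"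
    using shift by (auto simp: S_def)
  then have "AE f in ?PM. AE z in lborel. a + h f + A *v z \<notin> E"
    by (subst pair_sigma_finite.AE_commute[OF pair_sigma_finite_PiM_lborel[OF finB]]) measurable
  moreover have "AE z in lborel. \<mu> + A *v z \<notin> E" if "AE z in lborel. a + h f + A *v z \<notin> E" for f
  proof -
    obtain w where w: "h f = A *v w"
      using h_S[of f] by (auto simp: S_def)
    have "AE z in distr lborel borel ((+) (z0 + w)). \<mu> + A *v z \<notin> E"
      using that by (subst AE_distr_iff)
        (auto simp: z0 w matrix_vector_right_distrib add_ac)
    then show ?thesis
      unfolding lborel_distr_plus .
  qed
  ultimately have "AE f in ?PM. AE z in lborel. \<mu> + A *v z \<notin> E"
    by (auto elim: AE_mp)
  \<comment> \<open>The inner statement no longer depends on \<open>f\<close>, and the product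
    measure is nonzero.\<close>
  then have "AE z in lborel. \<mu> + A *v z \<notin> E"
    using not_AE_PiM_lborel_False[OF finB]
    by (cases "AE z in lborel. \<mu> + A *v z \<notin> E") simp_all
  then show ?thesis
    by eventually_elim (use E in auto)
qed

section \<open>Gaussian measures\<close>

text \<open>The versions in \<^theory>\<open>HOL-Analysis.Change_Of_Vars\<close> require a well-ordered index type. Here a
  transposition is composed of shears and reflections, so that no order on the indices is needed.\<close>

lemma
  fixes f :: "real^'n \<Rightarrow> real^'n"
  assumes f: "linear f" and S: "S \<in> lmeasurable"
  shows lmeasurable_linear_image: "f ` S \<in> lmeasurable"
    and measure_lebesgue_linear_image: "measure lebesgue (f ` S) = \<bar>det (matrix f)\<bar> * measure lebesgue S"
proof -
  define P where "P = (\<lambda>f :: real^'n \<Rightarrow> real^'n. linear f \<and> (\<forall>S\<in>lmeasurable. f ` S \<in> lmeasurable \<and>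
    measure lebesgue (f ` S) = \<bar>det (matrix f)\<bar> * measure lebesgue S))"
  have comp: "P (g \<circ> h)" if "P g" "P h" for g h
    using that unfolding P_def image_comp[symmetric]
    by (simp add: linear_compose matrix_compose det_mul abs_mult)
  have stretch: "P (\<lambda>x. \<chi> i. c i * x $ i)" for c
    by (auto simp: P_def measurable_stretch measure_stretch axis_def matrix_def det_diagonal
        vec_eq_iff algebra_simps intro!: linearI)
  have shear: "P (\<lambda>x. \<chi> i. if i = m then x $ m + x $ n else x $ i)" (is "P ?h") if mn: "m \<noteq> n" for m n
  proof -
    have lin: "linear ?h"
      by (rule linearI) (auto simp: algebra_simps vec_eq_iff)
    have "matrix ?h = (\<chi> i. if i = m then row m (mat 1) + 1 *s row n (mat 1) else row i (mat 1))"
      by (auto simp: matrix_def axis_def row_def mat_def vec_eq_iff)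
    then have det: "det (matrix ?h) = 1"
      using det_row_operation[OF mn, of "mat 1 :: real^'n^'n" 1] by simp
    have box: "measure lebesgue (?h ` cbox a b) = 1 * measure lebesgue (cbox a b)" for a b
    proof (cases "cbox a b = {}")
      case False
      \<comment> \<open>Translating the box along axis \<open>n\<close> makes its lower
        \<open>n\<close>-th coordinate 0; \<open>measure_shear_interval\<close> needs this
        coordinate to be nonnegative.\<close>
      let ?v = "axis n (a $ n) :: real^'n"
      have "cbox a b = (+) ?v ` cbox (a - ?v) (b - ?v)"
        by (simp flip: cbox_translation)
      then have "?h ` cbox a b = (+) (?h ?v) ` ?h ` cbox (a - ?v) (b - ?v)"
        by (simp add: image_image linear_add[OF lin])
      then have "measure lebesgue (?h ` cbox a b) = measure lebesgue (?h ` cbox (a - ?v) (b - ?v))"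
        by (simp only: measure_translation)
      also have "\<dots> = measure lebesgue (cbox (a - ?v) (b - ?v))"
        using mn False \<open>cbox a b = _\<close> by (intro measure_shear_interval) (auto simp: axis_def)
      also have "\<dots> = measure lebesgue (cbox a b)"
        unfolding \<open>cbox a b = _\<close> by (rule measure_translation[symmetric])
      finally show ?thesis by simp
    qed simp
    show ?thesis
      unfolding P_def det
    proof (intro conjI lin ballI)
      fix S :: "(real^'n) set" assume "S \<in> lmeasurable"
      note m = measure_linear_sufficient[OF lin this box]
      show "?h ` S \<in> lmeasurable"
        by (rule m[THEN conjunct1])
      show "measure lebesgue (?h ` S) = \<bar>1\<bar> * measure lebesgue S"
        unfolding abs_one by (rule m[THEN conjunct2, symmetric])
    qed
  qed
  have "P f"
  proof (rule induct_linear_elementary[OF f])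
    fix m n :: 'n assume mn: "m \<noteq> n"
    let ?s = "\<lambda>m n (x :: real^'n). (\<chi> i. if i = m then x $ m + x $ n else x $ i) :: real^'n"
    let ?r = "\<lambda>x :: real^'n. (\<chi> i. (if i = m then -1 else 1) * x $ i) :: real^'n"
    \<comment> \<open>On the coordinates m and n, applying the maps from right to left takes (x, y)
      to (-x, y), (y-x, y), (x-y, y), (x-y, x), (y-x, x) and finally (y, x).\<close>
    have "(\<lambda>x. \<chi> i. x $ Transposition.transpose m n i)
        = ?s m n \<circ> (?r \<circ> (?s n m \<circ> (?r \<circ> (?s m n \<circ> ?r))))"
      using mn by (auto simp: fun_eq_iff vec_eq_iff Transposition.transpose_def)
    then show "P (\<lambda>x. \<chi> i. x $ Transposition.transpose m n i)"
      using mn by (simp only:) (intro comp stretch shear, auto)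
  next
    fix g :: "real^'n \<Rightarrow> real^'n" and i assume g: "linear g" and 0: "\<And>x. g x $ i = 0"
    have ninj: "\<not> inj g"
      using linear_injective_imp_surjective[OF g] 0 by (metis one_neq_zero surjD vec_component)
    then have "negligible (g ` S)" for S
      by (rule negligible_linear_singular_image[OF g])
    moreover have "det (matrix g) = 0"
      using ninj det_nz_iff_inj[OF g] by blast
    ultimately show "P g"
      using g by (simp add: P_def negligible_iff_measure)
  qed (rule comp stretch shear; assumption)+
  with S show "f ` S \<in> lmeasurable" "measure lebesgue (f ` S) = \<bar>det (matrix f)\<bar> * measure lebesgue S"
    by (auto simp: P_def)
qed
text \<open>Lebesgue measure is determined by the volumes of boxes, and the image measure scaled by
  \<open>\<bar>det B\<bar>\<close> gives each box its volume.\<close>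

lemma emeasure_lborel_affine_image:
  fixes B :: "real^'n^'n"
  assumes "invertible B" and S: "S \<in> sets borel"
  shows "emeasure lborel S = ennreal \<bar>det B\<bar> * emeasure lborel ((\<lambda>z. \<mu> + B *v z) -` S)"
proof -
  let ?t = "\<lambda>z. \<mu> + B *v z"
  define d where "d = \<bar>det B\<bar>"
  have d: "0 < d"
    using assms by (simp add: d_def invertible_det_nz)
  have [measurable]: "?t \<in> borel_measurable borel"
    by measurable
  have "lborel = density (distr lborel borel ?t) (\<lambda>_. ennreal d)"
  proof (rule lborel_eqI)
    fix l u :: "real^'n" assume lu: "\<And>b. b \<in> Basis \<Longrightarrow> l \<bullet> b \<le> u \<bullet> b"
    define Q where "Q = ?t -` box l u"
    define B' where "B' = matrix_inv B"
    have B': "B *v (B' *v x) = x" "B' *v (B *v x) = x" for x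
      using matrix_inv_inverse[OF assms(1)] by (simp_all add: matrix_vector_mul_assoc B'_def)
    have Q: "Q = (*v) B' ` ((+) (- \<mu>) ` box l u)"
    proof -
      have "z = B' *v (- \<mu> + (\<mu> + B *v z))" for z
        by (simp add: B')
      then show ?thesis
        unfolding Q_def by (force simp: B')
    qed
    have "(+) (- \<mu>) ` box l u \<in> lmeasurable"
      by (intro measurable_translation lmeasurable_box)
    then have Qm: "Q \<in> lmeasurable"
      unfolding Q by (rule lmeasurable_linear_image[OF matrix_vector_mul_linear])
    have Qb: "Q \<in> sets borel"
      unfolding Q_def by (intro measurable_sets_borel[of _ borel]) auto
    \<comment> \<open>\<open>Q\<close> was written as an image under the inverse to show that it is
      measurable with finite measure. Mapping it forward again produces the factor
      \<open>\<bar>det B\<bar>\<close>.\<close>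
    have "(+) \<mu> ` ((*v) B ` Q) = box l u"
      unfolding Q by (auto simp: image_image B')
    then have "measure lebesgue (box l u) = measure lebesgue ((*v) B ` Q)"
      by (metis measure_translation)
    also have "\<dots> = d * measure lebesgue Q"
      using Qm by (subst measure_lebesgue_linear_image) (auto simp: d_def)
    finally have "ennreal (measure lborel (box l u)) = ennreal d * ennreal (measure lebesgue Q)"
      using d by (simp add: ennreal_mult'')
    also have "ennreal (measure lebesgue Q) = emeasure lborel Q"
    proof -
      have "emeasure lborel Q \<noteq> top"
        using fmeasurableD2[OF Qm] Qb by simp
      then show ?thesis
        using Qb by (simp add: emeasure_eq_ennreal_measure)
    qed
    finally have "ennreal d * emeasure lborel Q = (\<Prod>b\<in>Basis. (u - l) \<bullet> b)"
      using lu by (simp add: measure_lborel_box)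
    then show "emeasure (density (distr lborel borel ?t) (\<lambda>_. ennreal d)) (box l u) = (\<Prod>b\<in>Basis. (u - l) \<bullet> b)"
      by (simp add: emeasure_density nn_integral_cmult_indicator emeasure_distr Q_def)
  qed simp
  then have "emeasure lborel S = emeasure (density (distr lborel borel ?t) (\<lambda>_. ennreal d)) S"
    by simp
  also have "\<dots> = ennreal d * emeasure lborel (?t -` S)"
    using S by (simp add: emeasure_density nn_integral_cmult_indicator emeasure_distr)
  finally show ?thesis
    by (simp add: d_def)
qed

lemma nn_integral_lborel_affine:
  fixes B :: "real^'n^'n"
  assumes "invertible B" and [measurable]: "f \<in> borel_measurable borel"
  shows "(\<integral>\<^sup>+y. f y \<partial>lborel) = ennreal \<bar>det B\<bar> * (\<integral>\<^sup>+z. f (\<mu> + B *v z) \<partial>lborel)"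
proof -
  define d where "d = ennreal \<bar>det B\<bar>"
  have "(lborel :: (real^'n) measure) = density (distr lborel borel (\<lambda>z. \<mu> + B *v z)) (\<lambda>_. d)"
    (is "_ = ?M")
  proof (rule measure_eqI)
    fix S :: "(real^'n) set" assume "S \<in> sets lborel"
    then have S: "S \<in> sets borel" by simp
    then have "emeasure ?M S = d * emeasure lborel ((\<lambda>z. \<mu> + B *v z) -` S)"
      by (simp add: emeasure_density nn_integral_cmult_indicator emeasure_distr)
    also have "\<dots> = emeasure lborel S"
      unfolding d_def by (rule emeasure_lborel_affine_image[OF assms(1) S, symmetric])
    finally show "emeasure lborel S = emeasure ?M S" ..
  qed simp
  then have "(\<integral>\<^sup>+y. f y \<partial>lborel) = (\<integral>\<^sup>+y. f y \<partial>?M)"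
    by (rule arg_cong[of _ _ "\<lambda>M. nn_integral M f"])
  also have "\<dots> = d * (\<integral>\<^sup>+z. f (\<mu> + B *v z) \<partial>lborel)"
    by (simp add: nn_integral_density nn_integral_distr nn_integral_cmult)
  finally show ?thesis
    unfolding d_def .
qed

section \<open>Gaussian densities and representation by the standard Gaussian measure\<close>

definition gaussian_density :: "real^'n \<Rightarrow> real^'n^'n \<Rightarrow> real^'n \<Rightarrow> real" where
  "gaussian_density \<mu> A y =
     exp (- ((y - \<mu>) \<bullet> (matrix_inv A *v (y - \<mu>))) / 2) / sqrt ((2 * pi) ^ CARD('n) * det A)"

abbreviation std_gaussian :: "(real^'n) measure" where
  "std_gaussian \<equiv> gaussian_measure 0 (mat 1)"

lemma gaussian_measure_eq: "gaussian_measure \<mu> A = density lborel (\<lambda>y. ennreal (gaussian_density \<mu> A y))"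
  by (simp add: gaussian_measure_def gaussian_density_def)

lemma sets_gaussian_measure [simp, measurable_cong]: "sets (gaussian_measure \<mu> A) = sets borel"
  by (simp add: gaussian_measure_eq)

lemma space_gaussian_measure [simp]: "space (gaussian_measure \<mu> A) = UNIV"
  by (simp add: gaussian_measure_eq)

lemma borel_measurable_gaussian_density [measurable]: "gaussian_density \<mu> A \<in> borel_measurable borel"
  unfolding gaussian_density_def by measurable

lemma gaussian_density_nonneg:
  assumes "0 \<le> det A"
  shows "0 \<le> gaussian_density \<mu> A y"
  using assms by (simp add: gaussian_density_def)

lemma matrix_inv_eqI:
  fixes A :: "real^'n^'n"
  assumes "A ** A' = mat 1"
  shows "matrix_inv A = A'"
proof -
  have "invertible A"
    using assms invertible_right_inverse by blast
  then show ?thesis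
    by (metis assms matrix_inv_inverse(2) matrix_mul_assoc matrix_mul_lid matrix_mul_rid)
qed

text \<open>The inverse covariance is \<open>transpose B' ** B'\<close> with \<open>B'\<close>
  inverse to \<open>B\<close>, so the quadratic form reduces to \<open>z \<bullet> z\<close>. The
  Jacobian factor on the left cancels the square root of the determinant.\<close>

lemma gaussian_density_affine:
  fixes B :: "real^'n^'n"
  assumes "invertible B"
  shows "\<bar>det B\<bar> * gaussian_density \<mu> (B ** transpose B) (\<mu> + B *v z) = gaussian_density 0 (mat 1) z"
proof -
  define B' where "B' = matrix_inv B"
  have B': "B ** B' = mat 1" "B' ** B = mat 1"
    using matrix_inv_inverse[OF assms] by (simp_all add: B'_def)
  have t: "transpose B ** transpose B' = mat 1"
    by (metis B'(2) matrix_transpose_mul transpose_mat)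
  have "(B ** transpose B) ** (transpose B' ** B') = mat 1"
    by (metis B'(1) t matrix_mul_assoc matrix_mul_rid)
  then have inv: "matrix_inv (B ** transpose B) = transpose B' ** B'"
    by (rule matrix_inv_eqI)
  have inv1: "matrix_inv (mat 1 :: real^'n^'n) = mat 1"
    by (rule matrix_inv_eqI) simp
  have "(B *v z) \<bullet> (matrix_inv (B ** transpose B) *v (B *v z)) = (B' *v (B *v z)) \<bullet> (B' *v (B *v z))"
    unfolding inv by (simp only: inner_matrix_vector_mult transpose_transpose flip: matrix_vector_mul_assoc)
  also have "\<dots> = z \<bullet> z"
    by (simp add: matrix_vector_mul_assoc B')
  finally have "(B *v z) \<bullet> (matrix_inv (B ** transpose B) *v (B *v z)) = z \<bullet> z" .
  moreover have "sqrt ((2 * pi) ^ CARD('n) * det (B ** transpose B)) = sqrt ((2 * pi) ^ CARD('n)) * \<bar>det B\<bar>"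
    by (simp add: det_mul det_transpose real_sqrt_mult flip: power2_eq_square)
  moreover have "det B \<noteq> 0"
    using assms by (simp add: invertible_det_nz)
  ultimately show ?thesis
    by (simp add: gaussian_density_def inv1)
qed

text \<open>Change of variables. It puts all Gaussian measures on one probability space, where
  almost sure limits in the factor can be taken.\<close>

lemma gaussian_measure_eq_distr:
  fixes B :: "real^'n^'n"
  assumes "invertible B"
  shows "gaussian_measure \<mu> (B ** transpose B) = distr std_gaussian borel (\<lambda>z. \<mu> + B *v z)"
proof (rule measure_eqI)
  fix S assume "S \<in> sets (gaussian_measure \<mu> (B ** transpose B))"
  then have S[measurable]: "S \<in> sets borel" by simp
  let ?g = "gaussian_density \<mu> (B ** transpose B)"
  have g0: "0 \<le> ?g y" for y
    by (intro gaussian_density_nonneg) (simp add: det_mul det_transpose)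
  have "emeasure (gaussian_measure \<mu> (B ** transpose B)) S = (\<integral>\<^sup>+y. ennreal (?g y) * indicator S y \<partial>lborel)"
    by (simp add: gaussian_measure_eq emeasure_density)
  also have "\<dots> = ennreal \<bar>det B\<bar> * (\<integral>\<^sup>+z. ennreal (?g (\<mu> + B *v z)) * indicator S (\<mu> + B *v z) \<partial>lborel)"
    by (rule nn_integral_lborel_affine[OF assms]) measurable
  also have "\<dots> = (\<integral>\<^sup>+z. ennreal \<bar>det B\<bar> * (ennreal (?g (\<mu> + B *v z)) * indicator S (\<mu> + B *v z)) \<partial>lborel)"
    by (rule nn_integral_cmult[symmetric]) measurable
  also have "\<dots> = (\<integral>\<^sup>+z. ennreal (gaussian_density 0 (mat 1) z) * indicator S (\<mu> + B *v z) \<partial>lborel)"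
    by (simp add: mult.assoc[symmetric] ennreal_mult'[symmetric] g0 gaussian_density_affine[OF assms])
  also have "\<dots> = emeasure std_gaussian ((\<lambda>z. \<mu> + B *v z) -` S)"
  proof -
    have "(\<lambda>z. \<mu> + B *v z) -` S \<in> sets borel"
      by (intro measurable_sets_borel[of _ borel]) auto
    then show ?thesis
      by (simp add: gaussian_measure_eq emeasure_density indicator_vimage)
  qed
  finally show "emeasure (gaussian_measure \<mu> (B ** transpose B)) S = emeasure (distr std_gaussian borel (\<lambda>z. \<mu> + B *v z)) S"
    by (simp add: emeasure_distr)
qed simp

text \<open>The density is a product of one-dimensional normal densities, so its integral is a
  product of integrals equal to 1.\<close>

lemma prob_space_std_gaussian: "prob_space (std_gaussian :: (real^'n) measure)"
proof
  have inv1: "matrix_inv (mat 1 :: real^'n^'n) = mat 1"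
    by (rule matrix_inv_eqI) simp
  have "gaussian_density 0 (mat 1) y = (\<Prod>b\<in>Basis. std_normal_density (y \<bullet> b))" for y :: "real^'n"
  proof -
    have "(\<Prod>b\<in>Basis. std_normal_density (y \<bullet> b))
        = (\<Prod>b\<in>(Basis :: (real^'n) set). exp (- (y \<bullet> b)\<^sup>2 / 2)) / sqrt (2 * pi) ^ CARD('n)"
      by (simp add: std_normal_density_def prod_dividef)
    also have "(\<Prod>b\<in>(Basis :: (real^'n) set). exp (- (y \<bullet> b)\<^sup>2 / 2)) = exp (- (y \<bullet> y) / 2)"
      by (simp add: exp_sum[symmetric] euclidean_inner[of y y] power2_eq_square sum_negf sum_divide_distrib)
    finally show ?thesis
      by (simp add: gaussian_density_def inv1 real_sqrt_power[symmetric] power_mult_distrib)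
  qed
  then have "emeasure (std_gaussian :: (real^'n) measure) UNIV
      = (\<integral>\<^sup>+y. (\<Prod>b\<in>Basis. ennreal (std_normal_density (y \<bullet> b))) \<partial>(lborel :: (real^'n) measure))"
    by (simp add: gaussian_measure_eq emeasure_density prod_ennreal)
  also have "\<dots> = (\<Prod>b\<in>(Basis :: (real^'n) set). \<integral>\<^sup>+x. ennreal (std_normal_density x) \<partial>lborel)"
    by (rule nn_integral_lborel_prod) auto
  also have "\<dots> = 1"
    by (simp add: nn_integral_eq_integral)
  finally show "emeasure (std_gaussian :: (real^'n) measure) (space std_gaussian) = 1"
    by simp
qed

lemma prob_space_gaussian_measure:
  fixes A :: "real^'n^'n"
  assumes "sym_pos_def A"
  shows "prob_space (gaussian_measure \<mu> A)"
proof -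
  obtain B :: "real^'n^'n" where B: "invertible B" "A = B ** transpose B"
    using sym_pos_def_factorization[OF assms] by blast
  show ?thesis
    unfolding B(2) gaussian_measure_eq_distr[OF B(1)]
    by (rule prob_space.prob_space_distr[OF prob_space_std_gaussian]) simp
qed

lemma det_sym_pos_def_nonneg:
  fixes A :: "real^'n^'n"
  assumes "sym_pos_def A"
  shows "0 \<le> det A"
proof -
  obtain B :: "real^'n^'n" where "A = B ** transpose B"
    using sym_pos_def_factorization[OF assms] by blast
  then show ?thesis
    by (simp add: det_mul det_transpose)
qed

text \<open>By Scheffe's lemma the Gaussian measures depend continuously on the mean even in total
  variation, so no regularity of the rejection region is needed.\<close>

lemma tendsto_measure_gaussian_mean:
  fixes A :: "real^'n^'n"
  assumes A: "sym_pos_def A" and m: "m \<longlonglongrightarrow> \<mu>" and S[measurable]: "S \<in> sets borel"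
  shows "(\<lambda>j. measure (gaussian_measure (m j) A) S) \<longlonglongrightarrow> measure (gaussian_measure \<mu> A) S"
proof -
  note nn = gaussian_density_nonneg[OF det_sym_pos_def_nonneg[OF A]]
  have one: "(\<integral>\<^sup>+y. ennreal (gaussian_density \<nu> A y) \<partial>lborel) = 1" for \<nu>
    using prob_space.emeasure_space_1[OF prob_space_gaussian_measure[OF A], of \<nu>]
    by (simp add: gaussian_measure_eq emeasure_density)
  have int: "integrable lborel (gaussian_density \<nu> A)" for \<nu>
    by (rule integrableI_nonneg) (auto simp: nn one)
  have meas: "measure (gaussian_measure \<nu> A) S = (LINT y:S|lborel. gaussian_density \<nu> A y)" for \<nu>
    unfolding gaussian_measure_eq set_lebesgue_integral_def
    by (subst measure_def, subst emeasure_density)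
      (auto simp: nn integral_eq_nn_integral ennreal_mult'' indicator_def intro!: arg_cong[of _ _ enn2real] nn_integral_cong)
  have "(\<lambda>j. gaussian_density (m j) A y) \<longlonglongrightarrow> gaussian_density \<mu> A y" for y
  proof -
    have "continuous_on UNIV ((*v) (matrix_inv A))"
      by (intro linear_continuous_on linear_conv_bounded_linear[THEN iffD1]) auto
    then have "(\<lambda>j. matrix_inv A *v (y - m j)) \<longlonglongrightarrow> matrix_inv A *v (y - \<mu>)"
      by (rule continuous_on_tendsto_compose) (auto intro!: tendsto_intros m)
    then show ?thesis
      unfolding gaussian_density_def divide_inverse by (intro tendsto_intros m)
  qed
  \<comment> \<open>All densities have integral 1, which settles the limsup condition of Scheffe's
    lemma; pointwise convergence then gives convergence in L1.\<close>
  then have "(\<lambda>j. \<integral>\<^sup>+y. norm (gaussian_density (m j) A y - gaussian_density \<mu> A y) \<partial>lborel) \<longlonglongrightarrow> 0"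
    by (intro Scheffe_lemma1 int) (auto simp: nn one Limsup_const)
  moreover have "(\<integral>\<^sup>+y. norm (gaussian_density (m j) A y - gaussian_density \<mu> A y) \<partial>lborel)
      = ennreal (\<integral>y. norm (gaussian_density (m j) A y - gaussian_density \<mu> A y) \<partial>lborel)" for j
    by (intro nn_integral_eq_integral integrable_norm Bochner_Integration.integrable_diff int) auto
  ultimately have lim: "(\<lambda>j. \<integral>y. norm (gaussian_density (m j) A y - gaussian_density \<mu> A y) \<partial>lborel) \<longlonglongrightarrow> 0"
    by (simp add: tendsto_ennreal_iff[of _ _ 0, simplified])
  \<comment> \<open>The L1 distance of the densities bounds the difference of the measures on every
    Borel set.\<close>
  have "norm (measure (gaussian_measure (m j) A) S - measure (gaussian_measure \<mu> A) S)
      \<le> (\<integral>y. norm (gaussian_density (m j) A y - gaussian_density \<mu> A y) \<partial>lborel)" for j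
  proof -
    have si: "set_integrable lborel S (gaussian_density \<nu> A)" for \<nu>
      unfolding set_integrable_def by (intro integrable_mult_indicator int) simp
    have "measure (gaussian_measure (m j) A) S - measure (gaussian_measure \<mu> A) S
        = (LINT y:S|lborel. gaussian_density (m j) A y - gaussian_density \<mu> A y)"
      unfolding meas by (intro set_integral_diff(2)[symmetric] si)
    also have "norm \<dots> \<le> (\<integral>y. norm (indicator S y *\<^sub>R (gaussian_density (m j) A y - gaussian_density \<mu> A y)) \<partial>lborel)"
      unfolding set_lebesgue_integral_def by (rule integral_norm_bound)
    also have "\<dots> \<le> (\<integral>y. norm (gaussian_density (m j) A y - gaussian_density \<mu> A y) \<partial>lborel)"
    proof (rule integral_mono)
      show "integrable lborel (\<lambda>y. norm (indicator S y *\<^sub>R (gaussian_density (m j) A y - gaussian_density \<mu> A y)))"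
        by (intro integrable_norm integrable_mult_indicator Bochner_Integration.integrable_diff int) simp
    qed (auto simp: indicator_def intro!: int)
    finally show ?thesis .
  qed
  then have "(\<lambda>j. measure (gaussian_measure (m j) A) S - measure (gaussian_measure \<mu> A) S) \<longlonglongrightarrow> 0"
    by (intro Lim_null_comparison[OF always_eventually lim]) blast
  then show ?thesis
    by (rule LIM_zero_cancel)
qed

section \<open>Rejection probabilities of invariant tests\<close>

lemma rej_prob_mult_transpose:
  fixes B :: "real^'n^'n"
  assumes "invertible B" and [measurable]: "T \<in> borel_measurable borel"
  shows "rej_prob T C \<mu> (B ** transpose B) = measure std_gaussian {z. C \<le> T (\<mu> + B *v z)}"
proof -
  have "{y. C \<le> T y} \<in> sets borel"
    by measurable
  moreover have "(\<lambda>z. \<mu> + B *v z) -` {y. C \<le> T y} = {z. C \<le> T (\<mu> + B *v z)}"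
    by auto
  ultimately show ?thesis
    by (simp add: rej_prob_def gaussian_measure_eq_distr[OF assms(1)] measure_distr)
qed

lemma rej_prob_nonneg: "0 \<le> rej_prob T C \<mu> A"
  by (simp add: rej_prob_def)

lemma rej_prob_le_1:
  assumes "sym_pos_def A"
  shows "rej_prob T C \<mu> A \<le> 1"
  unfolding rej_prob_def by (rule prob_space.prob_le_1[OF prob_space_gaussian_measure[OF assms]])

text \<open>The affine map sends the Gaussian measure on the right to the one on the left, since
  \<open>\<delta> *\<^sub>R B\<close> is a factor of the scaled covariance, and \<open>T\<close>
  does not see the map.\<close>

lemma rej_prob_affine:
  fixes A :: "real^'n^'n"
  assumes A: "sym_pos_def A" and T: "T \<in> borel_measurable borel"
    and \<delta>: "\<delta> \<noteq> 0" and inv: "\<And>y. T (\<delta> *\<^sub>R (y - a) + a') = T y"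
  shows "rej_prob T C (\<delta> *\<^sub>R (\<mu> - a) + a') (\<delta>\<^sup>2 *\<^sub>R A) = rej_prob T C \<mu> A"
proof -
  obtain B :: "real^'n^'n" where B: "invertible B" "A = B ** transpose B"
    using sym_pos_def_factorization[OF A] by blast
  have "\<delta>\<^sup>2 *\<^sub>R A = (\<delta> *\<^sub>R B) ** transpose (\<delta> *\<^sub>R B)"
    unfolding B(2) by (simp add: transpose_scalar scalar_matrix_assoc matrix_scalar_ac power2_eq_square
        flip: scalar_matrix_assoc)
  moreover have "invertible (\<delta> *\<^sub>R B)"
    using B(1) \<delta> by (simp add: scalar_invertible)
  moreover have "T (\<delta> *\<^sub>R (\<mu> - a) + a' + (\<delta> *\<^sub>R B) *v z) = T (\<mu> + B *v z)" for z
    using inv[of "\<mu> + B *v z"] by (simp add: algebra_simps flip: scaleR_matrix_vector_assoc)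
  ultimately show ?thesis
    using B by (simp add: rej_prob_mult_transpose T)
qed

lemma tendsto_rej_prob_mean:
  assumes "sym_pos_def A" "m \<longlonglongrightarrow> \<mu>" and [measurable]: "T \<in> borel_measurable borel"
  shows "(\<lambda>j. rej_prob T C (m j) A) \<longlonglongrightarrow> rej_prob T C \<mu> A"
  unfolding rej_prob_def by (rule tendsto_measure_gaussian_mean[OF assms(1,2)]) measurable

text \<open>Dominated convergence for indicators: almost surely \<open>f j x\<close> eventually
  stays on the same side of \<open>C\<close> as \<open>c\<close>. For \<open>C = c\<close> it could
  oscillate around the threshold.\<close>

lemma (in prob_space) tendsto_prob_ge_of_AE_tendsto_const:
  fixes f :: "nat \<Rightarrow> 'a \<Rightarrow> real"
  assumes [measurable]: "\<And>j. f j \<in> borel_measurable M" and lim: "AE x in M. (\<lambda>j. f j x) \<longlonglongrightarrow> c"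
    and "C \<noteq> c"
  shows "(\<lambda>j. prob {x \<in> space M. C \<le> f j x}) \<longlonglongrightarrow> of_bool (C < c)"
proof -
  have "(\<lambda>j. \<integral>x. indicat_real {x \<in> space M. C \<le> f j x} x \<partial>M) \<longlonglongrightarrow> (\<integral>x. of_bool (C < c) \<partial>M)"
  proof (rule integral_dominated_convergence[where w = "\<lambda>_. 1"])
    show "AE x in M. (\<lambda>j. indicator {x \<in> space M. C \<le> f j x} x :: real) \<longlonglongrightarrow> of_bool (C < c)"
      using lim AE_space
    proof eventually_elim
      case (elim x)
      have "eventually (\<lambda>j. (indicator {x \<in> space M. C \<le> f j x} x :: real) = of_bool (C < c)) sequentially"
      proof (cases "C < c")
        case True
        then show ?thesis
          using order_tendstoD(1)[OF elim(1) True] elim(2) by (auto elim!: eventually_mono)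
      next
        case False
        then have "c < C"
          using assms(3) by simp
        then show ?thesis
          using order_tendstoD(2)[OF elim(1) \<open>c < C\<close>] by (auto elim!: eventually_mono)
      qed
      then show ?case
        by (rule tendsto_eventually)
    qed
  qed (auto simp: indicator_def)
  then show ?thesis
    by (simp add: prob_space)
qed

section \<open>Infima of nonnegative functions\<close>

lemma cINF_eq_0_iff:
  fixes f :: "'a \<Rightarrow> real"
  assumes "A \<noteq> {}" and nn: "\<And>x. x \<in> A \<Longrightarrow> 0 \<le> f x"
  shows "(INF x\<in>A. f x) = 0 \<longleftrightarrow> (\<forall>e>0. \<exists>x\<in>A. f x < e)"
proof -
  have bdd: "bdd_below (f ` A)"
    using nn by (rule bdd_belowI2)
  have "0 \<le> (INF x\<in>A. f x)"
    using assms by (intro cINF_greatest) auto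
  then have "(INF x\<in>A. f x) = 0 \<longleftrightarrow> (\<forall>e>0. (INF x\<in>A. f x) < e)"
    by (metis less_eq_real_def less_irrefl)
  then show ?thesis
    using cINF_less_iff[OF assms(1) bdd] by simp
qed

text \<open>Nonnegativity supplies the lower bounds that the inner and outer real infima need in
  order to be genuine infima.\<close>

lemma cINF_cINF_eq_0I:
  fixes f :: "'a \<Rightarrow> 'b \<Rightarrow> real"
  assumes "A \<noteq> {}" "B \<noteq> {}" and nn: "\<And>x y. x \<in> A \<Longrightarrow> y \<in> B \<Longrightarrow> 0 \<le> f x y"
    and less: "\<And>e. 0 < e \<Longrightarrow> \<exists>x\<in>A. \<exists>y\<in>B. f x y < e"
  shows "(INF x\<in>A. INF y\<in>B. f x y) = 0"
proof -
  have "\<exists>x\<in>A. (INF y\<in>B. f x y) < e" if e: "0 < e" for e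
  proof -
    obtain x y where xy: "x \<in> A" "y \<in> B" "f x y < e"
      using less[OF e] by blast
    then have "(INF y\<in>B. f x y) \<le> f x y"
      using nn by (intro cINF_lower bdd_belowI2) auto
    with xy show ?thesis
      by (meson le_less_trans)
  qed
  moreover have "0 \<le> (INF y\<in>B. f x y)" if "x \<in> A" for x
    using that assms by (intro cINF_greatest) auto
  ultimately show ?thesis
    using cINF_eq_0_iff[OF assms(1), of "\<lambda>x. INF y\<in>B. f x y"] by simp
qed

text \<open>Positivity is not among the clauses of \<open>is_norm\<close>; it follows from the
  triangle inequality for \<open>x\<close> and \<open>-x\<close>.\<close>

lemma is_norm_pos:
  assumes "is_norm N" "x \<noteq> 0"
  shows "0 < N x"
proof -
  have "N 0 \<le> N x + N (- 1 *\<^sub>R x)"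
    using assms(1) unfolding is_norm_def by (metis add.right_inverse scaleR_minus1_left)
  moreover have "N (- 1 *\<^sub>R x) = \<bar>- 1\<bar> * N x" "N 0 = 0" "N x \<noteq> 0"
    using assms unfolding is_norm_def by blast+
  ultimately show ?thesis
    by simp
qed

lemma AE_False_lborel: "(AE x in (lborel :: 'a::euclidean_space measure). P) \<longleftrightarrow> P"
proof (cases P)
  case False
  have "emeasure (lborel :: 'a measure) (cbox 0 One) \<le> emeasure lborel (space (lborel :: 'a measure))"
    by (rule emeasure_space)
  then have "emeasure (lborel :: 'a measure) (space lborel) \<noteq> 0"
    by simp
  then show ?thesis
    using False by (simp add: trivial_limit_def[symmetric] ae_filter_eq_bot_iff)
qed simp

section \<open>Invariant tests with an abstract set of null means\<close>

locale invariant_test =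
  fixes M :: "(real^'n) set" and Cov :: "(real^'n^'n) set" and T :: "real^'n \<Rightarrow> real"
  assumes M_nonempty: "M \<noteq> {}"
    and Cov_nonempty: "Cov \<noteq> {}"
    and Cov_sym_pos_def: "\<Sigma> \<in> Cov \<Longrightarrow> sym_pos_def \<Sigma>"
    and T_measurable [measurable]: "T \<in> borel_measurable borel"
    and T_invariant: "fun_invariant (G_group M) T"
begin

lemma T_affine:
  assumes "\<delta> \<noteq> 0" "a \<in> M" "a' \<in> M"
  shows "T (\<delta> *\<^sub>R (y - a) + a') = T y"
proof -
  have "(\<lambda>y. \<delta> *\<^sub>R (y - a) + a') \<in> G_group M"
    using assms by (auto simp: G_group_def)
  then show ?thesis
    using T_invariant by (force simp: fun_invariant_def)
qed

text \<open>The group element with dilation factor \<open>sqrt \<sigma>2\<close> that takes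
  \<open>\<mu>'\<close> to \<open>\<mu>\<close> turns covariance \<open>\<Sigma>\<close> into
  \<open>\<sigma>2 *\<^sub>R \<Sigma>\<close>. The suprema and infima over null means and variances
  in (a) and (b) thus collapse.\<close>

lemma rej_prob_null:
  assumes "\<mu> \<in> M" "\<mu>' \<in> M" "0 < \<sigma>2" "\<Sigma> \<in> Cov"
  shows "rej_prob T C \<mu> (\<sigma>2 *\<^sub>R \<Sigma>) = rej_prob T C \<mu>' \<Sigma>"
  using rej_prob_affine[OF Cov_sym_pos_def[OF assms(4)] T_measurable _ T_affine, of "sqrt \<sigma>2" \<mu>' \<mu> C \<mu>'] assms
  by simp

lemma cond_a_iff:
  assumes "\<mu> \<in> M"
  shows "cond_a M Cov T C \<longleftrightarrow> (SUP \<Sigma>\<in>Cov. rej_prob T C \<mu> \<Sigma>) < 1"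
proof -
  have "(SUP \<Sigma>\<in>Cov. rej_prob T C \<mu>0 (\<sigma>2 *\<^sub>R \<Sigma>)) = (SUP \<Sigma>\<in>Cov. rej_prob T C \<mu> \<Sigma>)"
    if "\<mu>0 \<in> M" "0 < \<sigma>2" for \<mu>0 \<sigma>2
    by (intro SUP_cong refl rej_prob_null that assms)
  then show ?thesis
    using M_nonempty by (simp add: cond_a_def)
qed

lemma cond_b_iff:
  assumes "\<mu> \<in> M"
  shows "cond_b M Cov T C \<longleftrightarrow> (\<forall>e>0. \<exists>\<Sigma>\<in>Cov. rej_prob T C \<mu> \<Sigma> < e)"
proof -
  have "(INF \<Sigma>\<in>Cov. rej_prob T C \<mu>0 (\<sigma>2 *\<^sub>R \<Sigma>)) = (INF \<Sigma>\<in>Cov. rej_prob T C \<mu> \<Sigma>)"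
    if "\<mu>0 \<in> M" "0 < \<sigma>2" for \<mu>0 \<sigma>2
    by (intro INF_cong refl rej_prob_null that assms)
  then show ?thesis
    using M_nonempty cINF_eq_0_iff[OF Cov_nonempty rej_prob_nonneg]
    by (simp add: cond_b_def)
qed

text \<open>A small rejection probability at the null mean persists for nearby means by continuity,
  with \<open>\<Sigma>\<close> and \<open>\<sigma>2\<close> held fixed. The step sizes are nonzero,
  so a direction towards the alternative really leaves the null.\<close>

lemma cond_b_near_null:
  assumes b: "cond_b M Cov T C" and \<mu>: "\<mu> \<in> M" and "0 < \<sigma>2" "0 < e"
  obtains \<Sigma> j where "\<Sigma> \<in> Cov"
    "rej_prob T C (\<mu> + inverse (real (Suc j)) *\<^sub>R v) (\<sigma>2 *\<^sub>R \<Sigma>) < e"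
proof -
  obtain \<Sigma> where \<Sigma>: "\<Sigma> \<in> Cov" "rej_prob T C \<mu> \<Sigma> < e"
    using b \<open>0 < e\<close> cond_b_iff[OF \<mu>] by blast
  have "(\<lambda>j. \<mu> + inverse (real (Suc j)) *\<^sub>R v) \<longlonglongrightarrow> \<mu> + 0 *\<^sub>R v"
    by (intro tendsto_intros LIMSEQ_inverse_real_of_nat)
  then have "(\<lambda>j. rej_prob T C (\<mu> + inverse (real (Suc j)) *\<^sub>R v) (\<sigma>2 *\<^sub>R \<Sigma>)) \<longlonglongrightarrow> rej_prob T C \<mu> (\<sigma>2 *\<^sub>R \<Sigma>)"
    using \<Sigma> \<open>0 < \<sigma>2\<close> by (intro tendsto_rej_prob_mean sym_pos_def_scaleR Cov_sym_pos_def) auto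
  moreover have "rej_prob T C \<mu> (\<sigma>2 *\<^sub>R \<Sigma>) < e"
    using \<Sigma> rej_prob_null[OF \<mu> \<mu> \<open>0 < \<sigma>2\<close>] by simp
  ultimately have "eventually (\<lambda>j. rej_prob T C (\<mu> + inverse (real (Suc j)) *\<^sub>R v) (\<sigma>2 *\<^sub>R \<Sigma>) < e) sequentially"
    by (rule order_tendstoD(2))
  then show thesis
    using \<Sigma> that by (auto dest: eventually_happens)
qed

text \<open>A mean close to \<open>\<mu>\<close> on the segment to \<open>\<mu>1\<close> is carried
  to \<open>\<mu>1\<close> by the dilation about \<open>\<mu>\<close> that undoes the shrinking.
  This dilation multiplies the variance by \<open>\<delta>\<^sup>2\<close>.\<close>

lemma INF_rej_prob_fixed_mean:
  assumes b: "cond_b M Cov T C"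
  shows "(INF \<sigma>2\<in>{0<..}. INF \<Sigma>\<in>Cov. rej_prob T C \<mu>1 (\<sigma>2 *\<^sub>R \<Sigma>)) = 0"
proof (rule cINF_cINF_eq_0I)
  fix e :: real assume "0 < e"
  obtain \<mu> where \<mu>: "\<mu> \<in> M"
    using M_nonempty by blast
  obtain \<Sigma> j where \<Sigma>: "\<Sigma> \<in> Cov"
    "rej_prob T C (\<mu> + inverse (real (Suc j)) *\<^sub>R (\<mu>1 - \<mu>)) (1 *\<^sub>R \<Sigma>) < e"
    by (rule cond_b_near_null[OF b \<mu> zero_less_one \<open>0 < e\<close>])
  define \<delta> where "\<delta> = real (Suc j)"
  have "\<delta> \<noteq> 0"
    unfolding \<delta>_def by simp
  then have "\<delta> *\<^sub>R (\<mu> + inverse \<delta> *\<^sub>R (\<mu>1 - \<mu>) - \<mu>) + \<mu> = \<mu>1"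
    by simp
  then have "rej_prob T C \<mu>1 (\<delta>\<^sup>2 *\<^sub>R \<Sigma>) = rej_prob T C (\<mu> + inverse \<delta> *\<^sub>R (\<mu>1 - \<mu>)) \<Sigma>"
    using rej_prob_affine[OF Cov_sym_pos_def[OF \<Sigma>(1)] T_measurable \<open>\<delta> \<noteq> 0\<close> T_affine[OF \<open>\<delta> \<noteq> 0\<close> \<mu> \<mu>],
        of C "\<mu> + inverse \<delta> *\<^sub>R (\<mu>1 - \<mu>)"] by simp
  then have "rej_prob T C \<mu>1 (\<delta>\<^sup>2 *\<^sub>R \<Sigma>) < e"
    using \<Sigma>(2) by (simp add: \<delta>_def)
  then show "\<exists>\<sigma>2\<in>{0<..}. \<exists>\<Sigma>\<in>Cov. rej_prob T C \<mu>1 (\<sigma>2 *\<^sub>R \<Sigma>) < e"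
    using \<Sigma>(1) \<open>\<delta> \<noteq> 0\<close> by (intro bexI[of _ "\<delta>\<^sup>2"] bexI[of _ \<Sigma>]) auto
qed (use Cov_nonempty rej_prob_nonneg in auto)

text \<open>The description in \<open>H_const\<close> requires a unique constant. Changing the null
  mean is a translation in the group, so any two constants are both almost everywhere values of
  \<open>T (\<nu> + A *v z)\<close> and must agree, as \<open>lborel\<close> is nonzero.\<close>

lemma H_const_AE:
  fixes A :: "real^'m^'n"
  assumes S: "S \<in> H_set T M J" "S = range ((*v) A)" and \<mu>: "\<mu> \<in> M"
  shows "AE y in affine_lebesgue ((+) \<mu> ` S). T y = H_const T M S"
proof -
  have const: "c = c'" if "\<nu> \<in> M" "\<nu>' \<in> M"
    "AE y in affine_lebesgue ((+) \<nu> ` S). T y = c" "AE y in affine_lebesgue ((+) \<nu>' ` S). T y = c'" for \<nu> \<nu>' c c'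
  proof -
    have eq: "T (\<nu>' + A *v z) = T (\<nu> + A *v z)" for z
      using T_affine[of 1 \<nu> \<nu>' "\<nu> + A *v z"] that by (simp add: algebra_simps)
    have "AE z in lborel. T (\<nu> + A *v z) = c" "AE z in lborel. T (\<nu> + A *v z) = c'"
      using AE_affine_lebesgueD[OF that(3)[unfolded S(2)]] AE_affine_lebesgueD[OF that(4)[unfolded S(2)]]
      by (simp_all add: eq)
    then have "AE z in (lborel :: (real^'m) measure). c = c'"
      by eventually_elim simp
    then show ?thesis
      by (metis AE_False_lborel)
  qed
  obtain c where c: "AE y in affine_lebesgue ((+) \<mu> ` S). T y = c"
    using S \<mu> by (auto simp: H_set_def)
  have all: "AE y in affine_lebesgue ((+) \<nu> ` S). T y = c" if "\<nu> \<in> M" for \<nu>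
    using S(1) that const[OF \<mu> that c] by (auto simp: H_set_def)
  have "H_const T M S = c"
    unfolding H_const_def using all const[OF \<mu> \<mu> _ c] \<mu> by (intro the_equality) auto
  with c show ?thesis
    by simp
qed

end

lemma T_translate_span:
  fixes T :: "'a::real_vector \<Rightarrow> 'b"
  assumes "subspace U" "subspace V"
    and "\<And>u y. u \<in> U \<Longrightarrow> T (y + u) = T y" "\<And>v y. v \<in> V \<Longrightarrow> T (y + v) = T y"
    and "l \<in> span (U \<union> V)"
  shows "T (y + l) = T y"
proof -
  obtain u v where "u \<in> U" "v \<in> V" "l = u + v"
    using assms(5) span_eq_iff[THEN iffD2, OF assms(1)] span_eq_iff[THEN iffD2, OF assms(2)]
    by (auto simp: span_Un)
  then show ?thesis
    using assms(3)[of u y] assms(4)[of v "y + u"] by (simp add: add.assoc)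
qed

context invariant_test
begin

text \<open>A normalized covariance matrix is the Gram matrix of a rescaled projected factor of the
  covariance matrix, and the rescaling and projecting cannot be seen by the test statistic.\<close>

lemma rej_prob_normalized_cov:
  assumes N: "is_norm N" and L: "subspace L" "dim L < CARD('n)"
    and TL: "\<And>l y. l \<in> L \<Longrightarrow> T (y + l) = T y"
    and \<Sigma>: "\<Sigma> \<in> Cov" and \<mu>: "\<mu> \<in> M"
  obtains A :: "real^'n^'n" where "A ** transpose A = normalized_cov N L \<Sigma>"
    "\<And>C. rej_prob T C \<mu> \<Sigma> = measure std_gaussian {z. C \<le> T (\<mu> + A *v z)}"
proof -
  have spd: "sym_pos_def \<Sigma>"
    by (rule Cov_sym_pos_def[OF \<Sigma>])
  obtain B :: "real^'n^'n" where B: "invertible B" "\<Sigma> = B ** transpose B"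
    using sym_pos_def_factorization[OF spd] by blast
  define P where "P = proj_matrix (orthogonal_comp L)"
  note sub = subspace_orthogonal_comp[of L]
  have Pt: "transpose P = P"
    unfolding P_def by (rule proj_matrix_props(3)[OF sub])
  have PL: "x - P *v x \<in> L" for x
    using proj_matrix_props(2)[OF sub, of x] by (simp add: P_def orthogonal_comp_self[OF L(1)])
  have P_fix: "P *v x = x" if "x \<in> orthogonal_comp L" for x
  proof -
    have "x - P *v x \<in> orthogonal_comp L"
      using that proj_matrix_props(1)[OF sub, of x] subspace_diff[OF sub] by (simp add: P_def)
    then have "orthogonal (x - P *v x) (x - P *v x)"
      using PL[of x] unfolding orthogonal_comp_def by blast
    then show ?thesis
      by (simp add: orthogonal_def)
  qed
  define Q where "Q = P ** \<Sigma> ** P"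
  \<comment> \<open>The normalization divides by \<open>N Q\<close>. A nonzero \<open>x\<close>
    orthogonal to \<open>L\<close> exists by the dimension bound and is fixed by \<open>P\<close>,
    so the quadratic form of \<open>Q\<close> at \<open>x\<close> is that of
    \<open>\<Sigma>\<close>, which is positive.\<close>
  have "Q \<noteq> 0"
  proof
    assume "Q = 0"
    obtain x where x: "x \<noteq> 0" "\<And>y. y \<in> span L \<Longrightarrow> orthogonal x y"
      using orthogonal_to_subspace_exists[of L] L(2) by auto
    then have "P *v x = x"
      by (intro P_fix) (auto simp: orthogonal_comp_def orthogonal_commute span_base)
    then have "x \<bullet> (Q *v x) = x \<bullet> (\<Sigma> *v x)"
      unfolding Q_def matrix_vector_mul_assoc[symmetric] inner_matrix_vector_mult[of x P] Pt by simp
    then show False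
      using spd x(1) \<open>Q = 0\<close> by (auto simp: sym_pos_def_def)
  qed
  define c where "c = 1 / N Q"
  have c: "0 < c"
    using is_norm_pos[OF N \<open>Q \<noteq> 0\<close>] by (simp add: c_def)
  \<comment> \<open>The square root appears because the scalar enters twice in
    \<open>A ** transpose A\<close>.\<close>
  define A where "A = sqrt c *\<^sub>R (P ** B)"
  have "(P ** B) ** transpose (P ** B) = Q"
    unfolding Q_def B(2) by (simp add: matrix_transpose_mul Pt matrix_mul_assoc)
  then have "A ** transpose A = c *\<^sub>R Q"
    using c unfolding A_def
    by (simp add: transpose_scalar matrix_scalar_ac flip: scalar_matrix_assoc)
  moreover have "c *\<^sub>R Q = normalized_cov N L \<Sigma>"
    by (simp add: normalized_cov_def Let_def c_def Q_def P_def)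
  moreover have "T (\<mu> + A *v z) = T (\<mu> + B *v z)" for z
  proof -
    let ?w = "B *v z"
    \<comment> \<open>First the dilation about \<open>\<mu>\<close> is undone, then the component of
      \<open>?w\<close> in \<open>L\<close> removed by the projection is added back.\<close>
    have "\<mu> + A *v z = sqrt c *\<^sub>R (\<mu> + P *v ?w - \<mu>) + \<mu>"
      by (simp add: A_def matrix_vector_mul_assoc flip: scaleR_matrix_vector_assoc)
    then have "T (\<mu> + A *v z) = T (sqrt c *\<^sub>R (\<mu> + P *v ?w - \<mu>) + \<mu>)"
      by (rule arg_cong)
    also have "\<dots> = T (\<mu> + P *v ?w)"
      using c by (intro T_affine \<mu>) simp
    also have "\<dots> = T (\<mu> + P *v ?w + (?w - P *v ?w))"
      by (rule TL[OF PL, symmetric])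
    finally show ?thesis
      by simp
  qed
  ultimately show thesis
    using B by (intro that[of A]) (simp_all add: rej_prob_mult_transpose)
qed

lemma concentration:
  assumes N: "is_norm N" and L: "subspace L" "dim L < CARD('n)"
    and TL: "\<And>l y. l \<in> L \<Longrightarrow> T (y + l) = T y"
    and Nd: "closed Nd" "continuous_on (- Nd) T"
    and \<Sigma>: "\<Sigma>\<^sub>0 \<in> closure (normalized_cov N L ` Cov)" and \<mu>: "\<mu> \<in> M"
    and null: "AE y in affine_lebesgue ((+) \<mu> ` range ((*v) \<Sigma>\<^sub>0)). y \<notin> Nd"
    and const: "AE y in affine_lebesgue ((+) \<mu> ` range ((*v) \<Sigma>\<^sub>0)). T y = c"
  obtains s where "\<And>j. s j \<in> Cov"
    "\<And>C. C \<noteq> c \<Longrightarrow> (\<lambda>j. rej_prob T C \<mu> (s j)) \<longlonglongrightarrow> of_bool (C < c)"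
proof -
  obtain x where x: "\<And>j :: nat. x j \<in> normalized_cov N L ` Cov" "x \<longlonglongrightarrow> \<Sigma>\<^sub>0"
    using \<Sigma> by (auto simp: closure_sequential)
  then have "\<forall>j. \<exists>s\<in>Cov. x j = normalized_cov N L s"
    by blast
  then obtain s where s: "\<And>j. s j \<in> Cov" "\<And>j. x j = normalized_cov N L (s j)"
    by metis
  have "\<forall>j. \<exists>A :: real^'n^'n. A ** transpose A = x j \<and>
      (\<forall>C. rej_prob T C \<mu> (s j) = measure std_gaussian {z. C \<le> T (\<mu> + A *v z)})"
    unfolding s(2) by (metis rej_prob_normalized_cov[OF N L TL s(1) \<mu>])
  then obtain A :: "nat \<Rightarrow> real^'n^'n" where A: "\<And>j. A j ** transpose (A j) = x j"
    "\<And>j C. rej_prob T C \<mu> (s j) = measure std_gaussian {z. C \<le> T (\<mu> + A j *v z)}"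
    unfolding choice_iff by blast
  obtain K where K: "\<And>j. norm (x j) \<le> K"
    using convergent_imp_Bseq[OF convergentI[OF x(2)]] by (auto simp: Bseq_def)
  \<comment> \<open>The squared norm is the trace of \<open>x j\<close>, a sum of n diagonal
    entries, each at most \<open>K\<close>.\<close>
  have "norm (A j) \<le> sqrt (real CARD('n) * K)" for j
  proof -
    have "A j \<bullet> A j = (\<Sum>i\<in>UNIV. x j $ i $ i)"
      by (simp add: inner_self_eq_trace_mult_transpose A(1))
    also have "\<dots> \<le> (\<Sum>i\<in>(UNIV :: 'n set). K)"
    proof (rule sum_mono)
      fix i
      have "x j $ i $ i \<le> norm (x j $ i $ i)" by simp
      also have "\<dots> \<le> norm (x j $ i)" by (rule Finite_Cartesian_Product.norm_nth_le)
      also have "\<dots> \<le> norm (x j)" by (rule Finite_Cartesian_Product.norm_nth_le)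
      also have "\<dots> \<le> K" by (rule K)
      finally show "x j $ i $ i \<le> K" .
    qed
    finally show ?thesis
      by (simp add: norm_eq_sqrt_inner)
  qed
  then have "bounded (range A)"
    by (auto simp: bounded_iff)
  then obtain A\<^sub>0 and q :: "nat \<Rightarrow> nat" where q: "strict_mono q" "(A \<circ> q) \<longlonglongrightarrow> A\<^sub>0"
    using bounded_imp_convergent_subsequence by blast
  \<comment> \<open>Gram matrices depend continuously on the factor, so the limit of the factors is
    a factor of \<open>\<Sigma>\<^sub>0\<close>.\<close>
  have "(\<lambda>j. A (q j) ** transpose (A (q j))) \<longlonglongrightarrow> A\<^sub>0 ** transpose A\<^sub>0"
  proof (intro vec_tendstoI)
    fix i k
    have entry: "(D ** transpose D) $ i $ k = D $ i \<bullet> D $ k" for D :: "real^'n^'n"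
      by (simp add: matrix_matrix_mult_def transpose_def inner_vec_def)
    show "(\<lambda>j. (A (q j) ** transpose (A (q j))) $ i $ k) \<longlonglongrightarrow> (A\<^sub>0 ** transpose A\<^sub>0) $ i $ k"
      unfolding entry using q(2) by (intro tendsto_intros) (simp_all add: o_def)
  qed
  moreover have "(\<lambda>j. x (q j)) \<longlonglongrightarrow> \<Sigma>\<^sub>0"
    using LIMSEQ_subseq_LIMSEQ[OF x(2) q(1)] by (simp add: o_def)
  ultimately have A0: "A\<^sub>0 ** transpose A\<^sub>0 = \<Sigma>\<^sub>0"
    by (simp add: A(1) LIMSEQ_unique)
  then have range: "range ((*v) \<Sigma>\<^sub>0) = range ((*v) A\<^sub>0)"
    using range_mult_transpose[of A\<^sub>0] by simp
  have "AE z in lborel. \<mu> + A\<^sub>0 *v z \<notin> Nd \<and> T (\<mu> + A\<^sub>0 *v z) = c"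
    using AE_affine_lebesgueD[OF null[unfolded range]] AE_affine_lebesgueD[OF const[unfolded range]]
    by eventually_elim simp
  then have "AE z in lborel. (\<lambda>j. T (\<mu> + A (q j) *v z)) \<longlonglongrightarrow> c"
  proof eventually_elim
    case (elim z)
    have "(\<lambda>j. A (q j) *v z) \<longlonglongrightarrow> A\<^sub>0 *v z"
      using q(2) unfolding matrix_mult_dot by (intro tendsto_intros) (simp add: o_def)
    then have "(\<lambda>j. \<mu> + A (q j) *v z) \<longlonglongrightarrow> \<mu> + A\<^sub>0 *v z"
      by (intro tendsto_intros)
    moreover have "isCont T (\<mu> + A\<^sub>0 *v z)"
      using Nd elim by (simp add: continuous_on_eq_continuous_at open_Compl)
    ultimately show ?case
      using elim isCont_tendsto_compose by fastforce
  qed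
  \<comment> \<open>The standard Gaussian measure has a Lebesgue density, so it inherits the null
    sets.\<close>
  then have "AE z in std_gaussian. (\<lambda>j. T (\<mu> + A (q j) *v z)) \<longlonglongrightarrow> c"
    unfolding gaussian_measure_eq by (subst AE_density) (auto elim: eventually_mono)
  then have "(\<lambda>j. measure std_gaussian {z \<in> space std_gaussian. C \<le> T (\<mu> + A (q j) *v z)}) \<longlonglongrightarrow> of_bool (C < c)"
    if "C \<noteq> c" for C
    using that by (intro prob_space.tendsto_prob_ge_of_AE_tendsto_const[OF prob_space_std_gaussian]) measurable
  then show thesis
    by (intro that[of "s \<circ> q"]) (simp_all add: s(1) A(2) o_def)
qed

end

section \<open>Null and alternative means in the linear model\<close>

lemma subspace_M0_lin: "subspace (M0_lin X R)"
proof (rule subspaceI)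
  show "0 \<in> M0_lin X R"
    unfolding M0_lin_def by (intro CollectI exI[of _ 0]) simp
next
  fix u v assume "u \<in> M0_lin X R" "v \<in> M0_lin X R"
  then obtain \<beta> \<gamma> where "u = X *v \<beta>" "R *v \<beta> = 0" "v = X *v \<gamma>" "R *v \<gamma> = 0"
    by (auto simp: M0_lin_def)
  then show "u + v \<in> M0_lin X R"
    unfolding M0_lin_def by (intro CollectI exI[of _ "\<beta> + \<gamma>"]) (simp add: matrix_vector_right_distrib)
next
  fix c u assume "u \<in> M0_lin X R"
  then obtain \<beta> where "u = X *v \<beta>" "R *v \<beta> = 0"
    by (auto simp: M0_lin_def)
  then show "c *\<^sub>R u \<in> M0_lin X R"
    unfolding M0_lin_def by (intro CollectI exI[of _ "c *\<^sub>R \<beta>"]) (simp add: matrix_vector_mult_scaleR)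
qed

lemma M0_add_M0_lin:
  assumes "a \<in> M0 X R r" "u \<in> M0_lin X R"
  shows "a + u \<in> M0 X R r"
proof -
  obtain \<beta> \<gamma> where "a = X *v \<beta>" "R *v \<beta> = r" "u = X *v \<gamma>" "R *v \<gamma> = 0"
    using assms by (auto simp: M0_def M0_lin_def)
  then have "a + u = X *v (\<beta> + \<gamma>)" "R *v (\<beta> + \<gamma>) = r"
    by (simp_all add: matrix_vector_right_distrib)
  then show ?thesis
    unfolding M0_def by blast
qed

text \<open>Along the line from \<open>a\<close> to \<open>b\<close> the restriction value is
  \<open>r\<close> plus \<open>t\<close> times a nonzero vector.\<close>

lemma M0_add_scaleR_M1:
  assumes "a \<in> M0 X R r" "b \<in> M1 X R r" "t \<noteq> 0"
  shows "a + t *\<^sub>R (b - a) \<in> M1 X R r"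
proof -
  obtain \<beta> \<gamma> where *: "a = X *v \<beta>" "R *v \<beta> = r" "b = X *v \<gamma>" "R *v \<gamma> \<noteq> r"
    using assms by (auto simp: M0_def M1_def)
  have "a + t *\<^sub>R (b - a) = X *v (\<beta> + t *\<^sub>R (\<gamma> - \<beta>))"
    by (simp add: * matrix_vector_right_distrib matrix_vector_mult_scaleR matrix_vector_mult_diff_distrib)
  moreover have "R *v (\<beta> + t *\<^sub>R (\<gamma> - \<beta>)) = r + t *\<^sub>R (R *v \<gamma> - r)"
    by (simp add: * matrix_vector_right_distrib matrix_vector_mult_scaleR matrix_vector_mult_diff_distrib)
  then have "R *v (\<beta> + t *\<^sub>R (\<gamma> - \<beta>)) \<noteq> r"
    using * assms(3) by simp
  ultimately show ?thesis
    unfolding M1_def by blast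
qed

text \<open>Full row rank makes \<open>R\<close> surjective, so both \<open>r\<close> and the
  different vector \<open>r + 1\<close> are attained.\<close>

lemma M0_M1_nonempty:
  fixes R :: "real^'k^'q"
  assumes "rank R = CARD('q)"
  shows "M0 X R r \<noteq> {}" "M1 X R r \<noteq> {}"
proof -
  have "surj ((*v) R)"
    using assms full_rank_surjective by blast
  then have "\<exists>\<beta>. R *v \<beta> = w" for w
    by (metis surjD)
  moreover have "r + 1 \<noteq> r"
    by simp
  ultimately show "M0 X R r \<noteq> {}" "M1 X R r \<noteq> {}"
    unfolding M0_def M1_def by (auto, metis)
qed

section \<open>The assertions on size and power\<close>

theorem theorem4p2:
  fixes X :: "real^'k^'n" and R :: "real^'k^'q" and r :: "real^'q"
    and Cov :: "(real^'n^'n) set"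
    and T :: "real^'n \<Rightarrow> real" and Nd :: "(real^'n) set"
    and V L :: "(real^'n) set"
    and N :: "real^'n^'n \<Rightarrow> real"
    and H :: "(real^'n) set set"
  assumes "CARD('k) < CARD('n)" and "rank X = CARD('k)" and "rank R = CARD('q)"
    and "is_norm N"
    and "covariance_model Cov"
    and "T \<in> borel_measurable borel"
    and "closed Nd" and "continuous_on (- Nd) T"
    and "fun_invariant (G_group (M0 X R r)) T" and "set_invariant (G_group (M0 X R r)) Nd"
    and "subspace V"
    and "fun_invariant (translation_maps V) T" and "set_invariant (translation_maps V) Nd"
    and L_eq: "L = span (M0_lin X R \<union> V)" and "dim L < CARD('n)"
    and H_eq: "H = H_set T (M0 X R r) (J_set N L Cov)"
  shows
    "(\<forall>S1\<in>H. \<forall>S2\<in>H.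
        H_const T (M0 X R r) S1 \<noteq> H_const T (M0 X R r) S2 \<longrightarrow>
        (\<exists>\<mu>0\<in>M0 X R r. Nd \<in> null_sets (affine_lebesgue ((+) \<mu>0 ` S1))) \<longrightarrow>
        (\<exists>\<mu>0\<in>M0 X R r. Nd \<in> null_sets (affine_lebesgue ((+) \<mu>0 ` S2))) \<longrightarrow>
        (\<forall>C. cond_a (M0 X R r) Cov T C \<longrightarrow> cond_b (M0 X R r) Cov T C))
     \<and>
     (\<forall>S\<in>H.
        (\<exists>\<mu>0\<in>M0 X R r. Nd \<in> null_sets (affine_lebesgue ((+) \<mu>0 ` S))) \<longrightarrow>
        (\<forall>C. cond_a (M0 X R r) Cov T C \<longrightarrow>
              H_const T (M0 X R r) S \<le> C \<and>
              (C \<noteq> H_const T (M0 X R r) S \<longrightarrow> cond_b (M0 X R r) Cov T C)))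
     \<and>
     (\<forall>C. cond_b (M0 X R r) Cov T C \<longrightarrow>
        (\<forall>\<mu>1\<in>M1 X R r.
           (INF \<sigma>2\<in>{0<..}. INF \<Sigma>\<in>Cov. rej_prob T C \<mu>1 (\<sigma>2 *\<^sub>R \<Sigma>)) = 0) \<and>
        (\<forall>\<sigma>2>0.
           (INF \<mu>1\<in>M1 X R r. INF \<Sigma>\<in>Cov. rej_prob T C \<mu>1 (\<sigma>2 *\<^sub>R \<Sigma>)) = 0))"
proof -
  let ?M = "M0 X R r"
  note M_ne = M0_M1_nonempty[OF assms(3), of X r]
  interpret invariant_test ?M Cov T
    using assms M_ne by unfold_locales (auto simp: covariance_model_def)
  obtain a where a: "a \<in> ?M"
    using M_ne by blast
  have T_V: "T (y + v) = T y" if "v \<in> V" for v y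
    using assms(12) that by (force simp: fun_invariant_def translation_maps_def)
  \<comment> \<open>Translation by \<open>u\<close> is the group element with dilation factor 1 that
    takes \<open>a\<close> to \<open>a + u\<close>.\<close>
  have T_M0_lin: "T (y + u) = T y" if "u \<in> M0_lin X R" for u y
    using T_affine[OF _ a M0_add_M0_lin[OF a that], of 1 y] by (simp add: algebra_simps)
  have L: "subspace L"
    by (simp add: L_eq)
  have TL: "T (y + l) = T y" if "l \<in> L" for l y
    using T_translate_span[OF subspace_M0_lin[of X R] assms(11) T_M0_lin T_V] that by (simp add: L_eq)
  have part2: "H_const T ?M S \<le> C \<and> (C \<noteq> H_const T ?M S \<longrightarrow> cond_b ?M Cov T C)"
    if S: "S \<in> H" and Nd: "\<exists>\<mu>0\<in>?M. Nd \<in> null_sets (affine_lebesgue ((+) \<mu>0 ` S))"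
      and C: "cond_a ?M Cov T C" for S C
  proof -
    obtain \<mu> where \<mu>: "\<mu> \<in> ?M" "Nd \<in> null_sets (affine_lebesgue ((+) \<mu> ` S))"
      using Nd by blast
    obtain \<Sigma>\<^sub>0 where \<Sigma>\<^sub>0: "\<Sigma>\<^sub>0 \<in> closure (normalized_cov N L ` Cov)" "S = range ((*v) \<Sigma>\<^sub>0)"
      using S by (auto simp: H_eq H_set_def J_set_def span_columns_eq_range)
    define c where "c = H_const T ?M S"
    have const: "AE y in affine_lebesgue ((+) \<mu> ` S). T y = c"
      using H_const_AE[OF S[unfolded H_eq] \<Sigma>\<^sub>0(2) \<mu>(1)] by (simp add: c_def)
    obtain s where s: "\<And>j. s j \<in> Cov"
      "\<And>C. C \<noteq> c \<Longrightarrow> (\<lambda>j. rej_prob T C \<mu> (s j)) \<longlonglongrightarrow> of_bool (C < c)"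
      using concentration[OF assms(4) L assms(15) TL assms(7,8) \<Sigma>\<^sub>0(1) \<mu>(1)
          AE_not_in[OF \<mu>(2), unfolded \<Sigma>\<^sub>0(2)] const[unfolded \<Sigma>\<^sub>0(2)]]
      by blast
    \<comment> \<open>Otherwise the rejection probabilities along \<open>s\<close> tend to 1, which
      contradicts (a).\<close>
    have "c \<le> C"
    proof (rule ccontr)
      assume "\<not> c \<le> C"
      then have "(\<lambda>j. rej_prob T C \<mu> (s j)) \<longlonglongrightarrow> 1"
        using s(2)[of C] by simp
      moreover have "rej_prob T C \<mu> (s j) \<le> (SUP \<Sigma>\<in>Cov. rej_prob T C \<mu> \<Sigma>)" for j
        by (intro cSUP_upper bdd_aboveI2[of _ _ 1] s(1) rej_prob_le_1 Cov_sym_pos_def)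
      ultimately have "1 \<le> (SUP \<Sigma>\<in>Cov. rej_prob T C \<mu> \<Sigma>)"
        by (intro LIMSEQ_le_const2) auto
      with C show False
        by (simp add: cond_a_iff[OF \<mu>(1)])
    qed
    moreover have "cond_b ?M Cov T C" if "C \<noteq> c"
      unfolding cond_b_iff[OF \<mu>(1)]
    proof (intro allI impI)
      fix e :: real assume "0 < e"
      have "(\<lambda>j. rej_prob T C \<mu> (s j)) \<longlonglongrightarrow> 0"
        using s(2)[OF that] \<open>c \<le> C\<close> by simp
      then have "eventually (\<lambda>j. rej_prob T C \<mu> (s j) < e) sequentially"
        using \<open>0 < e\<close> by (rule order_tendstoD)
      then show "\<exists>\<Sigma>\<in>Cov. rej_prob T C \<mu> \<Sigma> < e"
        using eventually_happens[of _ sequentially] s(1) by (metis sequentially_bot)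
    qed
    ultimately show ?thesis
      by (simp add: c_def)
  qed
  \<comment> \<open>\<open>C\<close> differs from at least one of the two distinct constants, and
    the second assertion applies to that space.\<close>
  moreover have "cond_b ?M Cov T C"
    if "S1 \<in> H" "S2 \<in> H" "H_const T ?M S1 \<noteq> H_const T ?M S2"
      "\<exists>\<mu>0\<in>?M. Nd \<in> null_sets (affine_lebesgue ((+) \<mu>0 ` S1))"
      "\<exists>\<mu>0\<in>?M. Nd \<in> null_sets (affine_lebesgue ((+) \<mu>0 ` S2))"
      "cond_a ?M Cov T C" for S1 S2 C
    using that part2[of S1 C] part2[of S2 C] by metis
  \<comment> \<open>Here the variance stays fixed, and the alternative mean moves along a segment
    towards the null mean \<open>a\<close>.\<close>
  moreover have "(INF \<mu>1\<in>M1 X R r. INF \<Sigma>\<in>Cov. rej_prob T C \<mu>1 (\<sigma>2 *\<^sub>R \<Sigma>)) = 0"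
    if C: "cond_b ?M Cov T C" and \<sigma>2: "0 < \<sigma>2" for C \<sigma>2
  proof (rule cINF_cINF_eq_0I)
    fix e :: real assume "0 < e"
    obtain b where b: "b \<in> M1 X R r"
      using M_ne by blast
    obtain \<Sigma> j where "\<Sigma> \<in> Cov" "rej_prob T C (a + inverse (real (Suc j)) *\<^sub>R (b - a)) (\<sigma>2 *\<^sub>R \<Sigma>) < e"
      using cond_b_near_null[OF C a \<sigma>2 \<open>0 < e\<close>] .
    moreover have "a + inverse (real (Suc j)) *\<^sub>R (b - a) \<in> M1 X R r"
      using M0_add_scaleR_M1[OF a b] by simp
    ultimately show "\<exists>\<mu>1\<in>M1 X R r. \<exists>\<Sigma>\<in>Cov. rej_prob T C \<mu>1 (\<sigma>2 *\<^sub>R \<Sigma>) < e"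
      by blast
  qed (use M_ne Cov_nonempty rej_prob_nonneg in auto)
  ultimately show ?thesis
    using INF_rej_prob_fixed_mean by blast
qed

end
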